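(* Let $A=(A_u)_{u\ge0}$ be a real Lévy process with $E(e^{ikA_u})=e^{u\psi(k)}$, and let $D=(D_u)_{u\ge0}$ be a strictly increasing driftless subordinator, independent of $A$, with $E(e^{-sD_u})=e^{u\phi(s)}$, $\phi(s)=\int_{\mathbb{R}_+}(e^{-sy}-1)K_2(dy)$, where $K_2$ is a measure on $[0,\infty)$ with $K_2(\{0\})=0$, $\int(y\wedge1)K_2(dy)<\infty$, $\int K_2(dy)=\infty$. Let $E_t=\inf\{u>0:D_u>t\}$ and $X_t=A_{E_t}$. For $n\in\mathbb{N}$ and $0<t_1<\dots<t_n$ let $$p(dx_1,\dots,dx_n;t_1,\dots,t_n)=P(X_{t_1}\in dx_1,\dots,X_{t_n}\in dx_n),\qquad h(du_1,\dots,du_n;t_1,\dots,t_n)=P(E_{t_1}\in du_1,\dots,E_{t_n}\in du_n),$$ and $z(dx_2,\dots,dx_n;u_2,\dots,u_n)=P(A_{u_2}\in dx_2,\dots,A_{u_n}\in dx_n)$. Then $$\Phi_{\mathbf t}\,p(d\mathbf x;\mathbf t)=\Psi_{\mathbf x}\,p(d\mathbf x;\mathbf t)+\int_{u_2=0}^\infty\int_{u_3=u_2}^\infty\cdots\int_{u_n=u_{n-1}}^\infty\delta_0(dx_1)\,z(dx_2,\dots,dx_n;u_2,\dots,u_n)\,h(0^+,du_2,\dots,du_n;t_1,\dots,t_n),$$ where $\Phi_{\mathbf t}$ and $\Psi_{\mathbf x}$ are the pseudo-differential operators with symbols $-\phi(\sum_{i=1}^ns_i)$ and $\psi(-\sum_{i=1}^nk_i)$.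 The equation is understood in the sense of Fourier–Laplace transforms: for all $\mathbf k\in\mathbb{R}^n$ and $\mathbf s\in(0,\infty)^n$, $$-\phi\Big(\sum_{i=1}^ns_i\Big)\overline p(\mathbf k;\mathbf s)=\psi\Big(-\sum_{i=1}^nk_i\Big)\overline p(\mathbf k;\mathbf s)+\int_{u_2=0}^\infty\cdots\int_{u_n=u_{n-1}}^\infty\widetilde z(k_2,\dots,k_n;u_2,\dots,u_n)\,\widehat h(0^+,du_2,\dots,du_n;s_1,\dots,s_n).$$
   Context: Conventions. $p(\cdot;\mathbf t)$ and $h(\cdot;\mathbf t)$ are taken to be $0$ when $\mathbf t$ does not satisfy $0<t_1<\dots<t_n$. Fourier–Laplace transform: $\overline p(\mathbf k;\mathbf s)=\int_{\mathbb{R}_+^n}\int_{\mathbb{R}^n}e^{-i\sum_jk_jx_j-\sum_js_jt_j}p(d\mathbf x;\mathbf t)\,d\mathbf t$. Fourier transform: $\widetilde z(k_2,\dots,k_n;u_2,\dots,u_n)=\int e^{-i\sum_{j=2}^nk_jx_j}z(dx_2,\dots,dx_n;u_2,\dots,u_n)$. An operator with symbol $\sigma(\mathbf k,\mathbf s)$ acts by multiplying the Fourier–Laplace transform by $\sigma$. Integrals over $u_2\le\dots\le u_n$ include the boundaries ($u_2=0$ and $u_i=u_{i-1}$), which may carry mass. For $n=1$ the last term is $\delta_0(dx_1)\,h(0^+;t_1)$. Meaning of $0^+$. $h(0^+,du_2,\dots,du_n;\mathbf t)$ is the limit as $u_1\to0^+$ of the density of $h$ in its first variable. At the level of transforms,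 $\widehat h(0^+,du_2,\dots,du_n;\mathbf s)$ is the measure whose Laplace transform in $(u_2,\dots,u_n)$ with parameters $\lambda_2,\dots,\lambda_n>0$ equals $\lim_{u_1\to0^+}\widehat h(u_1,\lambda_2,\dots,\lambda_n;\mathbf s)$, where $u_1\mapsto\widehat h(u_1,\lambda_2,\dots,\lambda_n;\mathbf s)$ is the (continuous version on $(0,\infty)$ of the) density of the measure $du_1\mapsto\int e^{-\sum_is_it_i-\sum_{i\ge2}\lambda_iu_i}h(du_1,du_2,\dots,du_n;\mathbf t)\,d\mathbf t$. *)

theory Defs
  imports "HOL-Probability.Probability"
begin

text \<open>Only the values \<^term>\<open>A u\<close> with \<^prop>\<open>u \<ge> (0::real)\<close> are relevant for a process \<^term>\<open>A\<close>.
  All paths are cadlag, so that \<^term>\<open>A\<close> may be evaluated at a random time even though the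
  probability space need not be complete.\<close>

definition levy_process :: "'a measure \<Rightarrow> (real \<Rightarrow> 'a \<Rightarrow> real) \<Rightarrow> bool" where
  "levy_process M A \<longleftrightarrow>
     prob_space M \<and>
     (\<forall>u\<ge>0. A u \<in> borel_measurable M) \<and>
     (AE \<omega> in M. A 0 \<omega> = 0) \<and>
     (\<forall>(m::nat) (u::nat \<Rightarrow> real). 0 \<le> u 0 \<and> (\<forall>j<m. u j < u (Suc j)) \<longrightarrow>
        prob_space.indep_vars M (\<lambda>_. borel) (\<lambda>j \<omega>. A (u (Suc j)) \<omega> - A (u j) \<omega>) {..<m}) \<and>
     (\<forall>u\<ge>0. \<forall>v\<ge>0.
        distr M borel (\<lambda>\<omega>. A (u + v) \<omega> - A u \<omega>) = distr M borel (\<lambda>\<omega>. A v \<omega> - A 0 \<omega>)) \<and>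
     (\<forall>\<omega>\<in>space M. \<forall>u\<ge>0. ((\<lambda>v. A v \<omega>) \<longlongrightarrow> A u \<omega>) (at_right u)) \<and>
     (\<forall>\<omega>\<in>space M. \<forall>u>0. \<exists>l. ((\<lambda>v. A v \<omega>) \<longlongrightarrow> l) (at_left u))"

definition subordinator :: "'a measure \<Rightarrow> (real \<Rightarrow> 'a \<Rightarrow> real) \<Rightarrow> bool" where
  "subordinator M D \<longleftrightarrow> levy_process M D \<and> (AE \<omega> in M. mono_on {0..} (\<lambda>u. D u \<omega>))"

definition strictly_increasing :: "'a measure \<Rightarrow> (real \<Rightarrow> 'a \<Rightarrow> real) \<Rightarrow> bool" where
  "strictly_increasing M D \<longleftrightarrow> (AE \<omega> in M. strict_mono_on {0..} (\<lambda>u. D u \<omega>))"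

definition indep_processes ::
    "'a measure \<Rightarrow> (real \<Rightarrow> 'a \<Rightarrow> real) \<Rightarrow> (real \<Rightarrow> 'a \<Rightarrow> real) \<Rightarrow> bool" where
  "indep_processes M A D \<longleftrightarrow>
     prob_space.indep_var M
       (PiM {0..} (\<lambda>_. borel)) (\<lambda>\<omega>. \<lambda>u\<in>{0..}. A u \<omega>)
       (PiM {0..} (\<lambda>_. borel)) (\<lambda>\<omega>. \<lambda>u\<in>{0..}. D u \<omega>)"

definition laplace_exponent :: "real measure \<Rightarrow> real \<Rightarrow> real" where
  "laplace_exponent K s = (LINT y|K. exp (- s * y) - 1)"

text \<open>The set below is empty only if the path of \<^term>\<open>D\<close> is bounded, which has probability zero
  for the subordinators considered here. That case is fixed to \<^term>\<open>0::real\<close>, since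
  \<^term>\<open>Inf {} :: real\<close> is an unspecified and possibly negative number.\<close>

definition inverse_process :: "(real \<Rightarrow> 'a \<Rightarrow> real) \<Rightarrow> real \<Rightarrow> 'a \<Rightarrow> real" where
  "inverse_process D t \<omega> =
     (if \<exists>u>0. D u \<omega> > t then Inf {u. u > 0 \<and> D u \<omega> > t} else 0)"

definition time_changed ::
    "(real \<Rightarrow> 'a \<Rightarrow> real) \<Rightarrow> (real \<Rightarrow> 'a \<Rightarrow> real) \<Rightarrow> real \<Rightarrow> 'a \<Rightarrow> real" where
  "time_changed A D t \<omega> = A (inverse_process D t \<omega>) \<omega>"

text \<open>Vectors with coordinates in \<^term>\<open>I :: nat set\<close> are functions on \<^term>\<open>I\<close>, that is,
  elements of \<^term>\<open>PiE I (\<lambda>_. UNIV :: real set)\<close>. For \<^prop>\<open>I = {}\<close> this is a single point.\<close>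

definition joint_law ::
    "'a measure \<Rightarrow> (real \<Rightarrow> 'a \<Rightarrow> real) \<Rightarrow> nat set \<Rightarrow> (nat \<Rightarrow> real) \<Rightarrow> (nat \<Rightarrow> real) measure" where
  "joint_law M Y I t = distr M (PiM I (\<lambda>_. borel)) (\<lambda>\<omega>. \<lambda>i\<in>I. Y (t i) \<omega>)"

definition ordered_times :: "nat \<Rightarrow> (nat \<Rightarrow> real) \<Rightarrow> bool" where
  "ordered_times n t \<longleftrightarrow> 0 < t 1 \<and> (\<forall>i\<in>{1..<n}. t i < t (Suc i))"

definition ordered_law ::
    "'a measure \<Rightarrow> (real \<Rightarrow> 'a \<Rightarrow> real) \<Rightarrow> nat \<Rightarrow> (nat \<Rightarrow> real) \<Rightarrow> (nat \<Rightarrow> real) measure" where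
  "ordered_law M Y n t =
     (if ordered_times n t then joint_law M Y {1..n} t else null_measure (PiM {1..n} (\<lambda>_. borel)))"

definition fourier_laplace ::
    "nat set \<Rightarrow> ((nat \<Rightarrow> real) \<Rightarrow> (nat \<Rightarrow> real) measure) \<Rightarrow> (nat \<Rightarrow> real) \<Rightarrow> (nat \<Rightarrow> real) \<Rightarrow> complex" where
  "fourier_laplace I p k s =
     (LINT t:PiE I (\<lambda>_. {0..})|PiM I (\<lambda>_. lborel).
        (LINT x|p t. exp (- \<i> * complex_of_real (\<Sum>j\<in>I. k j * x j)
                          - complex_of_real (\<Sum>j\<in>I. s j * t j))))"

definition fourier :: "nat set \<Rightarrow> (nat \<Rightarrow> real) measure \<Rightarrow> (nat \<Rightarrow> real) \<Rightarrow> complex" where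
  "fourier I z k = (LINT x|z. exp (- \<i> * complex_of_real (\<Sum>j\<in>I. k j * x j)))"

text \<open>The value on \<^term>\<open>B\<close> of the measure
  \<open>du\<^sub>1 \<mapsto> \<integral> exp (- \<Sum>\<^sub>i s\<^sub>i t\<^sub>i - \<Sum>\<^sub>i\<^sub>\<ge>\<^sub>2 l\<^sub>i u\<^sub>i) h(du\<^sub>1, du\<^sub>2, \<dots>, du\<^sub>n; t) dt\<close>.
  Negative times do not contribute when \<^term>\<open>h\<close> is an \<^const>\<open>ordered_law\<close>.\<close>

definition hhat_first ::
    "nat \<Rightarrow> ((nat \<Rightarrow> real) \<Rightarrow> (nat \<Rightarrow> real) measure) \<Rightarrow> (nat \<Rightarrow> real) \<Rightarrow> (nat \<Rightarrow> real) \<Rightarrow>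
     real set \<Rightarrow> ennreal" where
  "hhat_first n h s l B =
     (\<integral>\<^sup>+t. (\<integral>\<^sup>+u. ennreal (exp (- (\<Sum>i\<in>{1..n}. s i * t i) - (\<Sum>i\<in>{2..n}. l i * u i)))
                   * indicator B (u 1) \<partial>h t)
        \<partial>PiM {1..n} (\<lambda>_. lborel))"

text \<open>The values of \<^term>\<open>g\<close> on \<open>(0,\<infty>)\<close> are uniquely determined, by continuity.\<close>

definition hhat_density ::
    "nat \<Rightarrow> ((nat \<Rightarrow> real) \<Rightarrow> (nat \<Rightarrow> real) measure) \<Rightarrow> (nat \<Rightarrow> real) \<Rightarrow> (nat \<Rightarrow> real) \<Rightarrow>
     (real \<Rightarrow> real) \<Rightarrow> bool" where
  "hhat_density n h s l g \<longleftrightarrow>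
     continuous_on {0<..} g \<and> (\<forall>u>0. 0 \<le> g u) \<and>
     (\<forall>B\<in>sets borel. hhat_first n h s l B =
        (\<integral>\<^sup>+u. ennreal (g u) * indicator (B \<inter> {0<..}) u \<partial>lborel))"

definition is_hhat_zero_plus ::
    "nat \<Rightarrow> ((nat \<Rightarrow> real) \<Rightarrow> (nat \<Rightarrow> real) measure) \<Rightarrow> (nat \<Rightarrow> real) \<Rightarrow>
     (nat \<Rightarrow> real) measure \<Rightarrow> bool" where
  "is_hhat_zero_plus n h s \<mu> \<longleftrightarrow>
     sets \<mu> = sets (PiM {2..n} (\<lambda>_. borel)) \<and>
     (AE u in \<mu>. \<forall>i\<in>{2..n}. 0 \<le> u i) \<and>
     (\<forall>l. (\<forall>i\<in>{2..n}. 0 < l i) \<longrightarrow>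
        (\<exists>g L. hhat_density n h s l g \<and> (g \<longlongrightarrow> L) (at_right 0) \<and>
           (\<integral>\<^sup>+u. ennreal (exp (- (\<Sum>i\<in>{2..n}. l i * u i))) \<partial>\<mu>) = ennreal L))"

definition hhat_zero_plus ::
    "nat \<Rightarrow> ((nat \<Rightarrow> real) \<Rightarrow> (nat \<Rightarrow> real) measure) \<Rightarrow> (nat \<Rightarrow> real) \<Rightarrow> (nat \<Rightarrow> real) measure" where
  "hhat_zero_plus n h s = (THE \<mu>. is_hhat_zero_plus n h s \<mu>)"

text \<open>The domain of integration \<open>0 \<le> u\<^sub>2 \<le> \<dots> \<le> u\<^sub>n\<close>, boundaries included.\<close>

definition ordered_region :: "nat \<Rightarrow> (nat \<Rightarrow> real) set" where
  "ordered_region n =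
     {u \<in> PiE {2..n} (\<lambda>_. {0..}). \<forall>i\<in>{2..<n}. u i \<le> u (Suc i)}"

end

theory Submission
  imports Defs
begin

text \<open>
  Weight the ordered times \<open>t\<close> with \<open>exp (- \<Sum>\<^sub>i s\<^sub>i t\<^sub>i)\<close>, put \<open>S = \<Sum>\<^sub>i s\<^sub>i\<close>, and let \<open>G\<close> be the resulting law of
  \<open>(E\<^sub>1, (E\<^sub>i - E\<^sub>1)\<^sub>i\<^sub>\<ge>\<^sub>2)\<close>, where \<open>E\<^sub>i\<close> is the inverse of \<open>D\<close> at time \<open>t\<^sub>i\<close>. Almost surely \<open>E\<^sub>1 > a\<close> means \<open>t\<^sub>1 > D\<^sub>a\<close>, and
  then the increments \<open>E\<^sub>i - E\<^sub>1\<close> are those of the restarted subordinator at the times \<open>t\<^sub>i - D\<^sub>a\<close>. Translating the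
  times gives \<open>G ((a,\<infinity>) \<times> B) = exp (a \<phi>(S)) G (\<real> \<times> B)\<close>, so \<open>G\<close> is the product of \<open>exp (\<phi>(S) u) du\<close> on
  \<open>(0,\<infinity>)\<close> with a finite measure. That measure is \<open>h(0\<^sup>+, \<cdot>)\<close>: the density of \<open>h\<close> with Laplace parameters
  \<open>l\<^sub>i\<close> is \<open>exp ((\<phi>(S) - \<Sum>\<^sub>i l\<^sub>i) u)\<close> times its Laplace transform, and it has a limit as \<open>u\<close> tends to \<open>0\<close>.

  Conditionally on \<open>D\<close>, the characteristic function of \<open>A\<close> at the times \<open>E\<^sub>i\<close> splits at \<open>E\<^sub>1\<close> into
  \<open>exp (E\<^sub>1 \<psi>(- \<Sum>\<^sub>i k\<^sub>i))\<close> and the Fourier transform of \<open>z\<close> at the increments. Integrating over the product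
  \<open>G\<close> turns the first factor into \<open>- 1 / (\<phi>(S) + \<psi>(- \<Sum>\<^sub>i k\<^sub>i))\<close>, which is the equation.
\<close>

section \<open>Uniqueness of Laplace transforms\<close>

text \<open>The level \<open>a\<close> is deterministic, so restarting \<open>D\<close> there is the
  Markov property at a fixed time. The random amount \<open>D a\<close> enters only as a translation
  of the time vector: Lebesgue measure is invariant under it, and the weight loses the factor exp(-S
  D_a), whose mean is exp(a \<phi>(S)). Increments E_i - E_1 are used instead of positions because
  the restart adds \<open>a\<close> to all E_i at once. Back in positions, this common shift is the
  factor exp(-u sum l_i), which tends to 1 as u tends to 0; hence the law of the increments
  reappears as a measure in u_2, ..., u_n.

  The obstacle is that the restart and the independence of \<open>A\<close> and \<open>D\<close>
  concern whole paths, whereas the increments of a Levy process are known to be independent on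
  finite grids only. This forces a product law on path space and a description of E and X as
  measurable functionals of paths. Moreover \<open>hhat_zero_plus\<close> is a definite description
  through limits of Laplace transforms, so computing it takes uniqueness twice: of the continuous
  density, and of the measure with a given Laplace transform.\<close>

lemma finite_measure_eqI_laplace:
  fixes \<mu> \<nu> :: "real measure"
  assumes fin: "finite_measure \<mu>" "finite_measure \<nu>"
    and sets: "sets \<mu> = sets borel" "sets \<nu> = sets borel"
    and nonneg: "AE x in \<mu>. 0 \<le> x" "AE x in \<nu>. 0 \<le> x"
    and eq: "\<And>m::nat. (\<integral>\<^sup>+x. ennreal (exp (- (real m * x))) \<partial>\<mu>) = (\<integral>\<^sup>+x. ennreal (exp (- (real m * x))) \<partial>\<nu>)"
  shows "\<mu> = \<nu>"
proof -
  note sets [measurable_cong]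
  interpret \<mu>: finite_measure \<mu> by fact
  interpret \<nu>: finite_measure \<nu> by fact
  have int_exp: "integrable N (\<lambda>x. exp (- x) ^ m)"
    if "finite_measure N" "sets N = sets borel" "AE x in N. 0 \<le> x" for N :: "real measure" and m
  proof -
    note that(2) [measurable_cong]
    interpret finite_measure N by fact
    show ?thesis
      by (rule integrable_const_bound[where B = 1]) (use that(3) in \<open>auto simp: power_le_one\<close>)
  qed
  \<comment> \<open>Laplace transforms at natural numbers are the moments of exp(-x), a variable
    with values in [0,1] almost everywhere; the rest is the moment problem on a compact
    interval.\<close>
  have pow: "(\<integral>x. exp (- x) ^ m \<partial>\<mu>) = (\<integral>x. exp (- x) ^ m \<partial>\<nu>)" for m
  proof -
    have "ennreal (exp (- (real m * x))) = ennreal (exp (- x) ^ m)" for x :: real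
      by (simp flip: exp_of_nat_mult)
    then show ?thesis
      using eq[of m] by (simp add: integral_eq_nn_integral)
  qed
  \<comment> \<open>By Weierstrass, f is uniformly close on [0,1] to a polynomial, whose integrals
    agree by \<open>pow\<close>; the error is e times the total masses.\<close>
  have cont: "(\<integral>x. f (exp (- x)) \<partial>\<mu>) = (\<integral>x. f (exp (- x)) \<partial>\<nu>)"
    if f: "continuous_on UNIV f" for f :: "real \<Rightarrow> real"
  proof -
    have [measurable]: "f \<in> borel_measurable borel"
      using f by (rule borel_measurable_continuous_onI)
    obtain C where C: "\<And>y. y \<in> {0..1} \<Longrightarrow> \<bar>f y\<bar> \<le> C"
    proof -
      have "compact (f ` {0..1})"
        by (intro compact_continuous_image continuous_on_subset[OF f]) auto
      then have "bounded (f ` {0..1})" by (rule compact_imp_bounded)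
      then obtain a where "\<forall>x\<in>f ` {0..1}. \<bar>x\<bar> \<le> a"
        unfolding bounded_iff real_norm_def by blast
      then show ?thesis by (intro that[of a]) blast
    qed
    have int_f: "integrable N (\<lambda>x. f (exp (- x)))"
      if "finite_measure N" "sets N = sets borel" "AE x in N. 0 \<le> x" for N :: "real measure"
    proof -
      note that(2) [measurable_cong]
      interpret finite_measure N by fact
      show ?thesis
        by (rule integrable_const_bound[where B = C]) (use that(3) C in auto)
    qed
    have bound: "\<bar>(\<integral>x. f (exp (- x)) \<partial>\<mu>) - (\<integral>x. f (exp (- x)) \<partial>\<nu>)\<bar>
        \<le> e * (measure \<mu> (space \<mu>) + measure \<nu> (space \<nu>))" if "e > 0" for e
    proof -
      obtain g where "real_polynomial_function g"
        and g: "\<And>y. y \<in> {0..1} \<Longrightarrow> \<bar>f y - g y\<bar> < e"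
        using Stone_Weierstrass_real_polynomial_function[OF compact_Icc continuous_on_subset[OF f] \<open>e > 0\<close>]
        by (metis subset_UNIV)
      then obtain a d where g_eq: "g = (\<lambda>x. \<Sum>i\<le>d. a i * x ^ i)"
        by (auto simp: real_polynomial_function_iff_sum)
      have diff: "\<bar>(\<integral>x. f (exp (- x)) \<partial>N) - (\<integral>x. g (exp (- x)) \<partial>N)\<bar> \<le> e * measure N (space N)"
        if "finite_measure N" "sets N = sets borel" "AE x in N. 0 \<le> x" for N :: "real measure"
      proof -
        note that(2) [measurable_cong]
        interpret finite_measure N by fact
        have int_g: "integrable N (\<lambda>x. g (exp (- x)))"
          unfolding g_eq using int_exp[OF that] by auto
        have "\<bar>(\<integral>x. f (exp (- x)) \<partial>N) - (\<integral>x. g (exp (- x)) \<partial>N)\<bar>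
            = \<bar>\<integral>x. f (exp (- x)) - g (exp (- x)) \<partial>N\<bar>"
          using int_f[OF that] int_g by simp
        also have "\<dots> \<le> (\<integral>x. \<bar>f (exp (- x)) - g (exp (- x))\<bar> \<partial>N)"
          by (rule integral_abs_bound)
        also have "\<dots> \<le> (\<integral>x. e \<partial>N)"
        proof (rule integral_mono_AE)
          show "AE x in N. \<bar>f (exp (- x)) - g (exp (- x))\<bar> \<le> e"
            using that(3) by eventually_elim (simp add: g less_imp_le)
        qed (use int_f[OF that] int_g in auto)
        finally show ?thesis by (simp add: mult.commute)
      qed
      have "(\<integral>x. g (exp (- x)) \<partial>\<mu>) = (\<integral>x. g (exp (- x)) \<partial>\<nu>)"
        unfolding g_eq using int_exp fin sets nonneg by (simp add: pow)
      then show ?thesis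
        using diff[OF fin(1) sets(1) nonneg(1)] diff[OF fin(2) sets(2) nonneg(2)]
        by (simp add: algebra_simps)
    qed
    have "\<bar>(\<integral>x. f (exp (- x)) \<partial>\<mu>) - (\<integral>x. f (exp (- x)) \<partial>\<nu>)\<bar> \<le> 0"
    proof (rule field_le_epsilon)
      fix e :: real assume "e > 0"
      \<comment> \<open>The summand 1 keeps c positive when both measures vanish.\<close>
      define c where "c = measure \<mu> (space \<mu>) + measure \<nu> (space \<nu>) + 1"
      have "c > 0" by (simp add: c_def add_nonneg_pos)
      then show "\<bar>(\<integral>x. f (exp (- x)) \<partial>\<mu>) - (\<integral>x. f (exp (- x)) \<partial>\<nu>)\<bar> \<le> 0 + e"
        using bound[of "e / c"] \<open>e > 0\<close>
        by (auto intro!: order_trans[OF bound[of "e / c"]] simp: c_def field_simps)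
    qed
    then show ?thesis by simp
  qed
  have "measure \<mu> {a<..} = measure \<nu> {a<..}" for a
  proof -
    \<comment> \<open>Continuous ramps in y = exp(-x) that increase to the indicator of y < exp(-a),
      that is of x > a.\<close>
    define f where "f j y = min 1 (max 0 (real j * (exp (- a) - y)))" for j :: nat and y :: real
    have f_cont: "continuous_on UNIV (f j)" for j
      unfolding f_def by (intro continuous_intros)
    have lim: "(\<lambda>j. \<integral>x. f j (exp (- x)) \<partial>N) \<longlonglongrightarrow> measure N {a<..}"
      if "finite_measure N" "sets N = sets borel" for N :: "real measure"
    proof -
      note that(2) [measurable_cong]
      interpret finite_measure N by fact
      have [measurable]: "f j \<in> borel_measurable borel" for j
        by (rule borel_measurable_continuous_onI[OF f_cont])
      have "(\<lambda>j. \<integral>x. f j (exp (- x)) \<partial>N) \<longlonglongrightarrow> (\<integral>x. indicator {a<..} x \<partial>N)"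
      proof (rule integral_dominated_convergence[where w = "\<lambda>_. 1"])
        show "AE x in N. (\<lambda>j. f j (exp (- x))) \<longlonglongrightarrow> indicator {a<..} x"
        proof (rule AE_I2)
          fix x
          show "(\<lambda>j. f j (exp (- x))) \<longlonglongrightarrow> indicator {a<..} x"
          proof (cases "x > a")
            case True
            then have pos: "exp (- a) - exp (- x) > 0" by simp
            obtain j0 :: nat where j0: "1 / (exp (- a) - exp (- x)) \<le> real j0"
              using real_arch_simple by blast
            have "f j (exp (- x)) = 1" if "j \<ge> j0" for j
            proof -
              have "1 / (exp (- a) - exp (- x)) \<le> real j" using j0 that by linarith
              then have "1 \<le> real j * (exp (- a) - exp (- x))"
                using pos by (simp add: field_simps)
              then show ?thesis by (simp add: f_def)
            qed
            then show ?thesis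
              using True by (intro tendsto_eventually eventually_sequentiallyI[of j0]) simp
          next
            case False
            then have "real j * (exp (- a) - exp (- x)) \<le> 0" for j
              by (simp add: mult_nonneg_nonpos)
            then show ?thesis using False by (simp add: f_def max_absorb1)
          qed
        qed
      qed (auto simp: f_def)
      then show ?thesis using sets_eq_imp_space_eq[OF that(2)] by simp
    qed
    show ?thesis
      by (rule LIMSEQ_unique[OF lim[OF fin(1) sets(1)]])
        (use cont[OF f_cont] lim[OF fin(2) sets(2)] in simp)
  qed
  then show ?thesis
    by (intro measure_eqI_lessThan) (auto simp: sets \<mu>.emeasure_eq_measure \<nu>.emeasure_eq_measure)
qed

text \<open>Reduction to one dimension: with the factors of all other coordinates kept as a density,
  the image under a single coordinate is a finite measure on the line, to which the one-dimensional
  result applies. The exponents stay general in the induction, since the step needs the hypothesis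
  for every exponent at the new coordinate.\<close>

lemma finite_measure_PiM_eqI_laplace:
  fixes \<mu> \<nu> :: "('i \<Rightarrow> real) measure"
  assumes I: "finite I"
    and fin: "finite_measure \<mu>" "finite_measure \<nu>"
    and sets: "sets \<mu> = sets (PiM I (\<lambda>_. borel))" "sets \<nu> = sets (PiM I (\<lambda>_. borel))"
    and nonneg: "AE u in \<mu>. \<forall>i\<in>I. 0 \<le> u i" "AE u in \<nu>. \<forall>i\<in>I. 0 \<le> u i"
    and eq: "\<And>l::'i \<Rightarrow> nat. (\<integral>\<^sup>+u. ennreal (exp (- (\<Sum>i\<in>I. real (l i) * u i))) \<partial>\<mu>)
                = (\<integral>\<^sup>+u. ennreal (exp (- (\<Sum>i\<in>I. real (l i) * u i))) \<partial>\<nu>)"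
  shows "\<mu> = \<nu>"
proof -
  note sets [measurable_cong]
  have meas [measurable]: "(\<lambda>u. u i) \<in> borel_measurable (PiM I (\<lambda>_. borel))" if "i \<in> I" for i
    using that by (rule measurable_component_singleton)
  \<comment> \<open>Exponentials are traded for indicators one coordinate at a time.\<close>
  define W where "W J B l u = ennreal ((\<Prod>j\<in>J. indicator (B j) (u j)) * exp (- (\<Sum>i\<in>I - J. real (l i) * u i)))"
    for J and B :: "'i \<Rightarrow> real set" and l :: "'i \<Rightarrow> nat" and u
  have W_meas [measurable]: "W J B l \<in> borel_measurable (PiM I (\<lambda>_. borel))"
    if "J \<subseteq> I" "\<And>j. j \<in> J \<Longrightarrow> B j \<in> sets borel" for J B l
  proof -
    have [measurable]: "(\<lambda>u. indicator (B j) (u j) :: real) \<in> borel_measurable (PiM I (\<lambda>_. borel))"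
      if "j \<in> J" for j
    proof -
      have [measurable]: "B j \<in> sets borel" "(\<lambda>u. u j) \<in> borel_measurable (PiM I (\<lambda>_. borel))"
        using that \<open>J \<subseteq> I\<close> \<open>\<And>j. j \<in> J \<Longrightarrow> B j \<in> sets borel\<close> by auto
      show ?thesis by measurable
    qed
    show ?thesis unfolding W_def using that by measurable
  qed
  have main: "(\<integral>\<^sup>+u. W J B l u \<partial>\<mu>) = (\<integral>\<^sup>+u. W J B l u \<partial>\<nu>)"
    if "J \<subseteq> I" "\<And>j. j \<in> J \<Longrightarrow> B j \<in> sets borel" for J B l
    using finite_subset[OF that(1) I] that
  proof (induction J arbitrary: l rule: finite_induct)
    case empty
    then show ?case using eq[of l] by (simp add: W_def)
  next
    case (insert j J)
    have jI: "j \<in> I" and JI: "J \<subseteq> I" using insert.prems by auto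
    have BJ: "B i \<in> sets borel" if "i \<in> J" for i using insert.prems that by auto
    have Bj [measurable]: "B j \<in> sets borel" using insert.prems by auto
    have [measurable]: "(\<lambda>u. u j) \<in> borel_measurable (PiM I (\<lambda>_. borel))" using jI by measurable
    \<comment> \<open>The integrand without its factor for coordinate j. It is \<open>W\<close> with
      exponent 0 at j, which yields its measurability.\<close>
    define V where "V u = ennreal ((\<Prod>j\<in>J. indicator (B j) (u j)) * exp (- (\<Sum>i\<in>I - insert j J. real (l i) * u i)))" for u
    have V_eq: "V = (\<lambda>u. W J B (l(j := 0)) u)"
    proof -
      have "(\<Sum>i\<in>I - J. real ((l(j := 0)) i) * u i) = (\<Sum>i\<in>I - insert j J. real (l i) * u i)" for u
        using I by (intro sum.mono_neutral_cong_right) auto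
      then show ?thesis by (simp add: V_def W_def fun_eq_iff)
    qed
    have V_meas [measurable]: "V \<in> borel_measurable (PiM I (\<lambda>_. borel))"
      unfolding V_eq using JI BJ by (intro W_meas) auto
    \<comment> \<open>Its Laplace transform at m is the integral of
      \<open>W J B (l(j := m))\<close>, so the induction hypothesis gives equality for both
      measures. It is finite because V is at most 1 where the coordinates are nonnegative.\<close>
    define \<rho> where "\<rho> N = distr (density N V) borel (\<lambda>u. u j)" for N
    have \<rho>_nn: "(\<integral>\<^sup>+x. f x \<partial>\<rho> N) = (\<integral>\<^sup>+u. V u * f (u j) \<partial>N)"
      if [measurable_cong]: "sets N = sets (PiM I (\<lambda>_. borel))" and [measurable]: "f \<in> borel_measurable borel" for N f
      unfolding \<rho>_def by (simp add: nn_integral_distr nn_integral_density)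
    have V_exp: "V u * ennreal (exp (- (real m * u j))) = W J B (l(j := m)) u" for u m
    proof -
      have "(\<Sum>i\<in>I - J. real ((l(j := m)) i) * u i)
          = real m * u j + (\<Sum>i\<in>I - insert j J. real (l i) * u i)"
      proof -
        have "I - J = insert j (I - insert j J)" using jI insert.hyps by auto
        moreover have "(\<Sum>i\<in>insert j (I - insert j J). real ((l(j := m)) i) * u i)
            = real m * u j + (\<Sum>i\<in>I - insert j J. real ((l(j := m)) i) * u i)"
          using I by (subst sum.insert) auto
        moreover have "(\<Sum>i\<in>I - insert j J. real ((l(j := m)) i) * u i)
            = (\<Sum>i\<in>I - insert j J. real (l i) * u i)"
          by (intro sum.cong) auto
        ultimately show ?thesis by presburger
      qed
      then show ?thesis
        unfolding V_def W_def
        by (subst ennreal_mult[symmetric]) (simp_all only: exp_add minus_add_distrib mult_ac exp_ge_zero prod_nonneg indicator_pos_le mult_nonneg_nonneg)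
    qed
    have fin_\<rho>: "finite_measure (\<rho> N)"
      if N: "finite_measure N" "sets N = sets (PiM I (\<lambda>_. borel))" "AE u in N. \<forall>i\<in>I. 0 \<le> u i" for N
    proof
      interpret finite_measure N by fact
      have "emeasure (\<rho> N) (space (\<rho> N)) = (\<integral>\<^sup>+x. 1 \<partial>\<rho> N)" by simp
      also have "\<dots> = (\<integral>\<^sup>+u. V u \<partial>N)" using \<rho>_nn[OF N(2), of "\<lambda>_. 1"] by simp
      also have "\<dots> \<le> (\<integral>\<^sup>+u. 1 \<partial>N)"
      proof (rule nn_integral_mono_AE)
        show "AE u in N. V u \<le> 1"
          using N(3)
        proof eventually_elim
          case (elim u)
          have "(\<Prod>j\<in>J. indicator (B j) (u j) :: real) \<le> 1" by (intro prod_le_1) auto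
          moreover have "exp (- (\<Sum>i\<in>I - insert j J. real (l i) * u i)) \<le> 1"
            using elim by (auto intro!: sum_nonneg)
          ultimately show ?case unfolding V_def
            by (simp add: mult_le_one prod_nonneg)
        qed
      qed
      also have "\<dots> < \<infinity>" by (simp add: emeasure_eq_measure)
      finally show "emeasure (\<rho> N) (space (\<rho> N)) \<noteq> \<infinity>" by simp
    qed
    have nonneg_\<rho>: "AE x in \<rho> N. 0 \<le> x"
      if N [measurable_cong]: "sets N = sets (PiM I (\<lambda>_. borel))" and "AE u in N. \<forall>i\<in>I. 0 \<le> u i" for N
      unfolding \<rho>_def using that(2) jI by (subst AE_distr_iff) (auto simp: AE_density)
    have "\<rho> \<mu> = \<rho> \<nu>"
    proof (rule finite_measure_eqI_laplace)
      fix m :: nat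
      show "(\<integral>\<^sup>+x. ennreal (exp (- (real m * x))) \<partial>\<rho> \<mu>) = (\<integral>\<^sup>+x. ennreal (exp (- (real m * x))) \<partial>\<rho> \<nu>)"
        using insert.IH[OF JI BJ, of "l(j := m)"] sets by (simp add: \<rho>_nn V_exp fun_upd_def)
    qed (use fin sets nonneg in \<open>simp_all add: fin_\<rho> nonneg_\<rho>, simp_all add: \<rho>_def\<close>)
    then have "(\<integral>\<^sup>+x. indicator (B j) x \<partial>\<rho> \<mu>) = (\<integral>\<^sup>+x. indicator (B j) x \<partial>\<rho> \<nu>)" by simp
    then have "(\<integral>\<^sup>+u. V u * indicator (B j) (u j) \<partial>\<mu>) = (\<integral>\<^sup>+u. V u * indicator (B j) (u j) \<partial>\<nu>)"
      using sets by (simp only: \<rho>_nn[OF _ borel_measurable_indicator[OF Bj]])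
    moreover have "V u * indicator (B j) (u j) = W (insert j J) B l u" for u
      using insert.hyps by (auto simp: V_def W_def indicator_def)
    ultimately show ?case by simp
  qed
  show ?thesis
  proof (rule measure_eqI_PiM_infinite[OF sets])
    fix B :: "'i \<Rightarrow> real set" and J
    assume J: "finite J" "J \<subseteq> I" and B: "\<And>j. j \<in> J \<Longrightarrow> B j \<in> sets borel"
    have *: "emeasure N (prod_emb I (\<lambda>_. borel) J (Pi\<^sub>E J B)) = (\<integral>\<^sup>+u. W J B (\<lambda>_. 0) u \<partial>N)"
      if "sets N = sets (PiM I (\<lambda>_. borel))" for N
    proof -
      have "prod_emb I (\<lambda>_. borel) J (Pi\<^sub>E J B) \<in> sets N"
        using J B that by (auto intro!: sets_PiM_I)
      then have "emeasure N (prod_emb I (\<lambda>_. borel) J (Pi\<^sub>E J B))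
          = (\<integral>\<^sup>+u. indicator (prod_emb I (\<lambda>_. borel) J (Pi\<^sub>E J B)) u \<partial>N)" by simp
      also have "\<dots> = (\<integral>\<^sup>+u. W J B (\<lambda>_. 0) u \<partial>N)"
      proof (rule nn_integral_cong)
        fix u assume "u \<in> space N"
        then have "u \<in> space (PiM I (\<lambda>_. borel))" using that sets_eq_imp_space_eq by blast
        moreover have "(\<Prod>j\<in>J. indicator (B j) (u j) :: real) = (if \<forall>j\<in>J. u j \<in> B j then 1 else 0)"
          using J by (auto simp: indicator_def intro!: prod_zero)
        ultimately show "indicator (prod_emb I (\<lambda>_. borel) J (Pi\<^sub>E J B)) u = W J B (\<lambda>_. 0) u"
          using J by (auto simp: W_def prod_emb_iff space_PiM PiE_iff indicator_def)
      qed
      finally show ?thesis .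
    qed
    show "emeasure \<mu> (prod_emb I (\<lambda>_. borel) J (Pi\<^sub>E J B)) = emeasure \<nu> (prod_emb I (\<lambda>_. borel) J (Pi\<^sub>E J B))"
      using main[OF J(2) B] sets by (simp add: *)
  qed fact
qed

text \<open>Strictly positive parameters say nothing directly about the total mass, which may be
  infinite. Tilting by the density exp(-sum u_i) makes both measures finite and turns natural
  parameters l into l + 1 > 0. The tilt lies strictly between 0 and infinity, so it can be divided
  out again.\<close>

lemma measure_PiM_eqI_laplace:
  fixes \<mu> \<nu> :: "('i \<Rightarrow> real) measure"
  assumes I: "finite I"
    and sets: "sets \<mu> = sets (PiM I (\<lambda>_. borel))" "sets \<nu> = sets (PiM I (\<lambda>_. borel))"
    and nonneg: "AE u in \<mu>. \<forall>i\<in>I. 0 \<le> u i" "AE u in \<nu>. \<forall>i\<in>I. 0 \<le> u i"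
    and eq: "\<And>l. (\<And>i. i \<in> I \<Longrightarrow> 0 < l i) \<Longrightarrow>
       (\<integral>\<^sup>+u. ennreal (exp (- (\<Sum>i\<in>I. l i * u i))) \<partial>\<mu>) = (\<integral>\<^sup>+u. ennreal (exp (- (\<Sum>i\<in>I. l i * u i))) \<partial>\<nu>)"
    and fin: "\<And>l. (\<And>i. i \<in> I \<Longrightarrow> 0 < l i) \<Longrightarrow>
       (\<integral>\<^sup>+u. ennreal (exp (- (\<Sum>i\<in>I. l i * u i))) \<partial>\<mu>) < \<infinity>"
  shows "\<mu> = \<nu>"
proof -
  note sets [measurable_cong]
  have [measurable]: "(\<lambda>u. u i) \<in> borel_measurable (PiM I (\<lambda>_. borel))" if "i \<in> I" for i
    using that by (rule measurable_component_singleton)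
  define T where "T u = ennreal (exp (- (\<Sum>i\<in>I. u i)))" for u :: "'i \<Rightarrow> real"
  have T [measurable]: "T \<in> borel_measurable (PiM I (\<lambda>_. borel))"
    unfolding T_def by measurable
  have eq1: "(\<integral>\<^sup>+u. T u \<partial>\<mu>) = (\<integral>\<^sup>+u. T u \<partial>\<nu>)" "(\<integral>\<^sup>+u. T u \<partial>\<mu>) < \<infinity>"
    using eq[of "\<lambda>_. 1"] fin[of "\<lambda>_. 1"] by (simp_all add: T_def)
  have fin_T: "finite_measure (density N T)"
    if [measurable_cong]: "sets N = sets (PiM I (\<lambda>_. borel))" and "(\<integral>\<^sup>+u. T u \<partial>N) < \<infinity>" for N
    by (rule finite_measureI) (use that(2) in \<open>simp add: emeasure_density cong: nn_integral_cong\<close>)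
  have "density \<mu> T = density \<nu> T"
  proof (rule finite_measure_PiM_eqI_laplace[OF I])
    fix l :: "'i \<Rightarrow> nat"
    have *: "(\<integral>\<^sup>+u. ennreal (exp (- (\<Sum>i\<in>I. real (l i) * u i))) \<partial>density N T)
        = (\<integral>\<^sup>+u. ennreal (exp (- (\<Sum>i\<in>I. (real (l i) + 1) * u i))) \<partial>N)"
      if [measurable_cong]: "sets N = sets (PiM I (\<lambda>_. borel))" for N
      by (subst nn_integral_density)
        (auto simp: T_def sum.distrib algebra_simps exp_diff exp_add exp_minus divide_simps simp flip: ennreal_mult intro!: nn_integral_cong)
    show "(\<integral>\<^sup>+u. ennreal (exp (- (\<Sum>i\<in>I. real (l i) * u i))) \<partial>density \<mu> T)
        = (\<integral>\<^sup>+u. ennreal (exp (- (\<Sum>i\<in>I. real (l i) * u i))) \<partial>density \<nu> T)"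
      using eq[of "\<lambda>i. real (l i) + 1"] sets by (simp add: * add_nonneg_pos)
  qed (use eq1 sets nonneg in \<open>auto intro!: fin_T simp: AE_density\<close>)
  then have "density (density \<mu> T) (\<lambda>u. inverse (T u)) = density (density \<nu> T) (\<lambda>u. inverse (T u))"
    by simp
  moreover have "density (density N T) (\<lambda>u. inverse (T u)) = N"
    if [measurable_cong]: "sets N = sets (PiM I (\<lambda>_. borel))" for N
  proof -
    have "T u * inverse (T u) = 1" for u
      unfolding T_def by (simp add: inverse_ennreal flip: ennreal_mult)
    then show ?thesis by (simp add: density_density_eq density_1)
  qed
  ultimately show ?thesis using sets by simp
qed

section \<open>The Markov property of Levy processes\<close>

text \<open>The Levy axioms speak of successive increments along a grid, cylinder sets of values at
  arbitrary finite sets of times. Values are partial sums of increments, which translates one into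
  the other. The set S serves every path and every base b, so shifted and unshifted processes are
  compared through the same event.\<close>

lemma finite_dim_set_via_increments:
  fixes A :: "real \<Rightarrow> real set"
  assumes J: "finite J" "J \<subseteq> {0..}" and A: "\<And>j. j \<in> J \<Longrightarrow> A j \<in> sets borel"
  obtains m :: nat and v S where "v 0 = 0" "\<And>j. j < m \<Longrightarrow> v j < v (Suc j)"
    "S \<in> sets (PiM {..<m} (\<lambda>_. borel))"
    "\<And>(x::real \<Rightarrow> real) b. (\<forall>j\<in>J. x (b + j) - x b \<in> A j)
        \<longleftrightarrow> (\<lambda>j\<in>{..<m}. x (b + v (Suc j)) - x (b + v j)) \<in> S"
proof -
  \<comment> \<open>Inserting 0 makes the grid start at the base point, so that the partial sums
    telescope to x (b + j) - x b.\<close>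
  define xs where "xs = sorted_list_of_set (insert 0 J)"
  define v where "v i = xs ! i" for i
  define m where "m = length xs - 1"
  have set_xs: "set xs = insert 0 J"
    unfolding xs_def using J by (intro set_sorted_list_of_set) simp
  have sorted: "sorted_wrt (<) xs"
    unfolding xs_def by (rule strict_sorted_list_of_set)
  have "xs \<noteq> []" using set_xs by auto
  then have len: "length xs = Suc m" by (simp add: m_def)
  have inc: "v j < v (Suc j)" if "j < m" for j
    using sorted len that unfolding v_def by (simp add: sorted_wrt_iff_nth_less)
  have v0: "v 0 = 0"
  proof -
    obtain i where i: "i < length xs" "xs ! i = 0" using set_xs by (metis in_set_conv_nth insertI1)
    have "v 0 \<le> 0"
      using i sorted_wrt_nth_less[OF sorted, of 0 i] by (cases "i = 0") (auto simp: v_def)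
    moreover have "v 0 \<in> insert 0 J" using set_xs len by (metis nth_mem v_def zero_less_Suc)
    ultimately show ?thesis using J by auto
  qed
  define S where "S = {f \<in> space (PiM {..<m} (\<lambda>_. borel)). \<forall>i\<in>{i. i \<le> m \<and> v i \<in> J}. (\<Sum>k<i. f k) \<in> A (v i)}"
  have "S \<in> sets (PiM {..<m} (\<lambda>_. borel))"
  proof -
    have "(\<lambda>f. \<Sum>k<i. f k) \<in> borel_measurable (PiM {..<m} (\<lambda>_. borel :: real measure))" if "i \<le> m" for i
      using that by (intro borel_measurable_sum measurable_component_singleton) auto
    then have "{f \<in> space (PiM {..<m} (\<lambda>_. borel)). (\<Sum>k<i. f k) \<in> A (v i)} \<in> sets (PiM {..<m} (\<lambda>_. borel))"
      if "i \<in> {i. i \<le> m \<and> v i \<in> J}" for i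
      using that A[of "v i"] by (intro pred_sets2[unfolded pred_def]) auto
    then show ?thesis unfolding S_def by (intro sets.sets_Collect_countable_All' countable_finite) auto
  qed
  moreover have "(\<forall>j\<in>J. x (b + j) - x b \<in> A j) \<longleftrightarrow> (\<lambda>j\<in>{..<m}. x (b + v (Suc j)) - x (b + v j)) \<in> S"
    for x :: "real \<Rightarrow> real" and b
  proof -
    have tele: "(\<Sum>k<i. (\<lambda>j\<in>{..<m}. x (b + v (Suc j)) - x (b + v j)) k) = x (b + v i) - x b" if "i \<le> m" for i
    proof -
      have "(\<Sum>k<i. (\<lambda>j\<in>{..<m}. x (b + v (Suc j)) - x (b + v j)) k) = (\<Sum>k<i. x (b + v (Suc k)) - x (b + v k))"
        using that by (intro sum.cong) auto
      then show ?thesis by (simp add: sum_lessThan_telescope[of "\<lambda>k. x (b + v k)"] v0)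
    qed
    have ex: "\<exists>i\<le>m. v i = j" if "j \<in> J" for j
    proof -
      have "j \<in> set xs" using that set_xs by blast
      then obtain i where "i < length xs" "xs ! i = j"
        unfolding in_set_conv_nth by blast
      then show ?thesis using len by (intro exI[of _ i]) (simp add: v_def)
    qed
    have J_iff: "(\<forall>j\<in>J. x (b + j) - x b \<in> A j) \<longleftrightarrow> (\<forall>i\<in>{i. i \<le> m \<and> v i \<in> J}. x (b + v i) - x b \<in> A (v i))"
      (is "?L \<longleftrightarrow> ?R")
    proof
      assume R: ?R
      show ?L
      proof
        fix j assume "j \<in> J"
        then obtain i where "i \<le> m" "v i = j" using ex by blast
        then show "x (b + j) - x b \<in> A j" using R \<open>j \<in> J\<close> by auto
      qed
    qed auto
    define r where "r = (\<lambda>j\<in>{..<m}. x (b + v (Suc j)) - x (b + v j))"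
    have "r \<in> space (PiM {..<m} (\<lambda>_. borel))" by (simp add: r_def space_PiM)
    then have "r \<in> S \<longleftrightarrow> (\<forall>i\<in>{i. i \<le> m \<and> v i \<in> J}. (\<Sum>k<i. r k) \<in> A (v i))"
      by (simp add: S_def)
    also have "\<dots> \<longleftrightarrow> (\<forall>i\<in>{i. i \<le> m \<and> v i \<in> J}. x (b + v i) - x b \<in> A (v i))"
      by (intro ball_cong refl) (simp add: tele[folded r_def])
    finally show ?thesis unfolding J_iff by (simp only: r_def)
  qed
  ultimately show ?thesis using v0 inc by (intro that[of v m S])
qed

lemma levy_processD:
  assumes "levy_process M X"
  shows "prob_space M"
    and "\<And>u. 0 \<le> u \<Longrightarrow> X u \<in> borel_measurable M"
    and "AE \<omega> in M. X 0 \<omega> = 0"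
    and "\<And>m u. 0 \<le> u 0 \<Longrightarrow> (\<And>j. j < m \<Longrightarrow> u j < u (Suc j)) \<Longrightarrow>
        prob_space.indep_vars M (\<lambda>_. borel) (\<lambda>j \<omega>. X (u (Suc j)) \<omega> - X (u j) \<omega>) {..<m::nat}"
    and "\<And>u v. 0 \<le> u \<Longrightarrow> 0 \<le> v \<Longrightarrow>
        distr M borel (\<lambda>\<omega>. X (u + v) \<omega> - X u \<omega>) = distr M borel (\<lambda>\<omega>. X v \<omega> - X 0 \<omega>)"
    and "\<And>\<omega> u. \<omega> \<in> space M \<Longrightarrow> 0 \<le> u \<Longrightarrow> ((\<lambda>v. X v \<omega>) \<longlongrightarrow> X u \<omega>) (at_right u)"
  using assms unfolding levy_process_def by blast+

text \<open>By independence the joint law is the product of its marginals, and each marginal depends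
  only on the length of its interval. The case \<open>m = 0\<close> is apart because the product
  criterion for independence asks for a nonempty index set.\<close>

lemma levy_increments_stationary:
  assumes levy: "levy_process M X" and "0 \<le> b" "v 0 = 0" and v: "\<And>j. j < m \<Longrightarrow> v j < v (Suc j)"
  shows "distr M (PiM {..<m::nat} (\<lambda>_. borel)) (\<lambda>\<omega>. \<lambda>j\<in>{..<m}. X (b + v (Suc j)) \<omega> - X (b + v j) \<omega>)
    = distr M (PiM {..<m} (\<lambda>_. borel)) (\<lambda>\<omega>. \<lambda>j\<in>{..<m}. X (v (Suc j)) \<omega> - X (v j) \<omega>)"
proof (cases "m = 0")
  case False
  interpret prob_space M by (rule levy_processD(1)[OF levy])
  note [measurable] = levy_processD(2)[OF levy]
  have v_nonneg: "0 \<le> v j" if "j \<le> m" for j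
    using that
  proof (induction j)
    case (Suc j)
    then show ?case using v[of j] by simp
  qed (simp add: \<open>v 0 = 0\<close>)
  have *: "distr M (PiM {..<m} (\<lambda>_. borel)) (\<lambda>\<omega>. \<lambda>j\<in>{..<m}. X (c + v (Suc j)) \<omega> - X (c + v j) \<omega>)
      = PiM {..<m} (\<lambda>j. distr M borel (\<lambda>\<omega>. X (v (Suc j) - v j) \<omega> - X 0 \<omega>))" if "0 \<le> c" for c
  proof -
    have "indep_vars (\<lambda>_. borel) (\<lambda>j \<omega>. X (c + v (Suc j)) \<omega> - X (c + v j) \<omega>) {..<m}"
      using v that \<open>v 0 = 0\<close> by (intro levy_processD(4)[OF levy, of "\<lambda>j. c + v j"]) auto
    moreover have "(\<lambda>\<omega>. X (c + v (Suc j)) \<omega> - X (c + v j) \<omega>) \<in> borel_measurable M" if "j \<in> {..<m}" for j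
      using that \<open>0 \<le> c\<close> v_nonneg[of j] v_nonneg[of "Suc j"] by (intro borel_measurable_diff) auto
    ultimately have "distr M (PiM {..<m} (\<lambda>_. borel)) (\<lambda>\<omega>. \<lambda>j\<in>{..<m}. X (c + v (Suc j)) \<omega> - X (c + v j) \<omega>)
        = PiM {..<m} (\<lambda>j. distr M borel (\<lambda>\<omega>. X (c + v (Suc j)) \<omega> - X (c + v j) \<omega>))"
      using False by (subst (asm) indep_vars_iff_distr_eq_PiM') auto
    also have "\<dots> = PiM {..<m} (\<lambda>j. distr M borel (\<lambda>\<omega>. X (v (Suc j) - v j) \<omega> - X 0 \<omega>))"
    proof (intro PiM_cong refl)
      fix j assume "j \<in> {..<m}"
      then show "distr M borel (\<lambda>\<omega>. X (c + v (Suc j)) \<omega> - X (c + v j) \<omega>)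
          = distr M borel (\<lambda>\<omega>. X (v (Suc j) - v j) \<omega> - X 0 \<omega>)"
        using levy_processD(5)[OF levy, of "c + v j" "v (Suc j) - v j"] \<open>0 \<le> c\<close> v_nonneg[of j] v[of j]
        by simp
    qed
    finally show ?thesis .
  qed
  show ?thesis using *[OF \<open>0 \<le> b\<close>] *[of 0] by simp
qed (simp add: restrict_def)

lemma levy_increments_indep:
  assumes levy: "levy_process M X" and "0 < a" "v 0 = 0" and v: "\<And>j. j < m \<Longrightarrow> v j < v (Suc j)"
    and B [measurable]: "B \<in> sets borel" and S [measurable]: "S \<in> sets (PiM {..<m} (\<lambda>_. borel))"
  shows "measure M {\<omega> \<in> space M. X a \<omega> - X 0 \<omega> \<in> B \<and> (\<lambda>j\<in>{..<m::nat}. X (a + v (Suc j)) \<omega> - X (a + v j) \<omega>) \<in> S}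
    = measure M {\<omega> \<in> space M. X a \<omega> - X 0 \<omega> \<in> B}
      * measure M {\<omega> \<in> space M. (\<lambda>j\<in>{..<m}. X (a + v (Suc j)) \<omega> - X (a + v j) \<omega>) \<in> S}"
proof -
  interpret prob_space M by (rule levy_processD(1)[OF levy])
  \<comment> \<open>Time 0 is put in front of the shifted grid: increment number 0 is X a - X 0, as
    v 0 = 0, and number j + 1 is the j-th increment after a. The grid stays strictly increasing
    because 0 < a.\<close>
  define u where "u k = (case k of 0 \<Rightarrow> 0 | Suc j \<Rightarrow> a + v j)" for k
  define \<Delta> where "\<Delta> j \<omega> = X (u (Suc j)) \<omega> - X (u j) \<omega>" for j \<omega>
  have "indep_vars (\<lambda>_. borel) \<Delta> {..<Suc m}"
    unfolding \<Delta>_def using v \<open>0 < a\<close> \<open>v 0 = 0\<close>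
    by (intro levy_processD(4)[OF levy]) (auto simp: u_def split: nat.split)
  then have indep: "indep_var (PiM {0} (\<lambda>_. borel)) (\<lambda>\<omega>. restrict (\<lambda>j. \<Delta> j \<omega>) {0})
      (PiM {1..m} (\<lambda>_. borel)) (\<lambda>\<omega>. restrict (\<lambda>j. \<Delta> j \<omega>) {1..m})"
    by (rule indep_var_restrict) auto
  define B' where "B' = {f \<in> space (PiM {0::nat} (\<lambda>_. borel)). f 0 \<in> B}"
  define S' where "S' = {f \<in> space (PiM {1..m} (\<lambda>_. borel)). (\<lambda>j\<in>{..<m}. f (Suc j)) \<in> S}"
  have "(\<lambda>f. \<lambda>j\<in>{..<m}. f (Suc j)) \<in> PiM {1..m} (\<lambda>_. borel) \<rightarrow>\<^sub>M PiM {..<m} (\<lambda>_. borel :: real measure)"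
    by (intro measurable_restrict measurable_component_singleton) auto
  then have "S' \<in> sets (PiM {1..m} (\<lambda>_. borel))" unfolding S'_def by measurable
  moreover have "B' \<in> sets (PiM {0} (\<lambda>_. borel))" unfolding B'_def by measurable
  moreover have "restrict (\<lambda>j. \<Delta> j \<omega>) {0} \<in> B' \<longleftrightarrow> X a \<omega> - X 0 \<omega> \<in> B" for \<omega>
    using \<open>v 0 = 0\<close> by (simp add: B'_def space_PiM \<Delta>_def u_def)
  moreover have "restrict (\<lambda>j. \<Delta> j \<omega>) {1..m} \<in> S' \<longleftrightarrow> (\<lambda>j\<in>{..<m}. X (a + v (Suc j)) \<omega> - X (a + v j) \<omega>) \<in> S" for \<omega>
  proof -
    have "(\<lambda>j\<in>{..<m}. restrict (\<lambda>j. \<Delta> j \<omega>) {1..m} (Suc j)) = (\<lambda>j\<in>{..<m}. X (a + v (Suc j)) \<omega> - X (a + v j) \<omega>)"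
      by (auto simp: fun_eq_iff \<Delta>_def u_def)
    then show ?thesis by (simp add: S'_def space_PiM)
  qed
  ultimately show ?thesis
    using indep_varD[OF indep, of B' S'] by (simp add: vimage_def Int_def conj_commute)
qed

section \<open>Paths as random elements of a product space\<close>

abbreviation sample_path :: "(real \<Rightarrow> 'a \<Rightarrow> real) \<Rightarrow> 'a \<Rightarrow> real \<Rightarrow> real" where
  "sample_path X \<omega> \<equiv> \<lambda>u\<in>{0..}. X u \<omega>"

abbreviation path_space :: "(real \<Rightarrow> real) measure" where
  "path_space \<equiv> PiM {0..} (\<lambda>_. borel)"

lemma measurable_sample_path:
  assumes "\<And>u. 0 \<le> u \<Longrightarrow> X u \<in> borel_measurable M"
  shows "sample_path X \<in> M \<rightarrow>\<^sub>M path_space"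
  using assms by (intro measurable_restrict) auto

text \<open>The Markov property at a fixed time, for whole paths. A product law is determined by
  rectangles B \<times> C. For fixed B both sides are finite measures in C, hence determined by
  cylinder sets, and these are events about increments on a finite grid.\<close>

theorem levy_process_shift:
  assumes levy: "levy_process M X" and a: "0 \<le> a"
  shows "distr M (borel \<Otimes>\<^sub>M path_space) (\<lambda>\<omega>. (X a \<omega>, sample_path (\<lambda>u \<omega>. X (a + u) \<omega> - X a \<omega>) \<omega>))
    = distr M borel (X a) \<Otimes>\<^sub>M distr M path_space (sample_path X)"
proof -
  interpret prob_space M by (rule levy_processD(1)[OF levy])
  note X [measurable] = levy_processD(2)[OF levy]
  note [measurable] = X[OF a] X[of 0, simplified]
  have path [measurable]: "sample_path X \<in> M \<rightarrow>\<^sub>M path_space"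
    using X by (rule measurable_sample_path)
  have shift [measurable]: "sample_path (\<lambda>u \<omega>. X (a + u) \<omega> - X a \<omega>) \<in> M \<rightarrow>\<^sub>M path_space"
    using a by (intro measurable_sample_path borel_measurable_diff X) auto
  interpret Xa: prob_space "distr M borel (X a)" by (rule prob_space_distr) simp
  interpret pX: prob_space "distr M path_space (sample_path X)" by (rule prob_space_distr) simp
  have indep: "prob {\<omega> \<in> space M. X a \<omega> \<in> B \<and> (\<lambda>j\<in>{..<m}. X (a + v (Suc j)) \<omega> - X (a + v j) \<omega>) \<in> S}
      = prob {\<omega> \<in> space M. X a \<omega> \<in> B} * prob {\<omega> \<in> space M. (\<lambda>j\<in>{..<m}. X (v (Suc j)) \<omega> - X (v j) \<omega>) \<in> S}"
    if v: "v 0 = 0" "\<And>j. j < m \<Longrightarrow> v j < v (Suc j)" and B [measurable]: "B \<in> sets borel"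
      and S [measurable]: "S \<in> sets (PiM {..<m} (\<lambda>_. borel))" for v B S and m :: nat
  proof -
    have v_nonneg: "0 \<le> v j" if "j \<le> m" for j
      using that
    proof (induction j)
      case (Suc j)
      then show ?case using v(2)[of j] by simp
    qed (simp add: v)
    have inc [measurable]: "(\<lambda>\<omega>. \<lambda>j\<in>{..<m}. X (c + v (Suc j)) \<omega> - X (c + v j) \<omega>) \<in> M \<rightarrow>\<^sub>M PiM {..<m} (\<lambda>_. borel)"
      if "0 \<le> c" for c
      using that v_nonneg by (intro measurable_restrict borel_measurable_diff X) auto
    note [measurable] = inc[OF a] inc[of 0, simplified]
    show ?thesis
    proof (cases "a = 0")
      \<comment> \<open>At a = 0 the grid with 0 in front would repeat a point; here X 0 is almost
        surely constant, so independence is trivial.\<close>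
      case True
      have "prob {\<omega> \<in> space M. X 0 \<omega> \<in> B \<and> (\<lambda>j\<in>{..<m}. X (v (Suc j)) \<omega> - X (v j) \<omega>) \<in> S}
          = prob {\<omega> \<in> space M. 0 \<in> B \<and> (\<lambda>j\<in>{..<m}. X (v (Suc j)) \<omega> - X (v j) \<omega>) \<in> S}"
        using levy_processD(3)[OF levy] by (intro finite_measure_eq_AE) auto
      moreover have "prob {\<omega> \<in> space M. X 0 \<omega> \<in> B} = prob {\<omega> \<in> space M. 0 \<in> B}"
        using levy_processD(3)[OF levy] by (intro finite_measure_eq_AE) auto
      ultimately show ?thesis using True by (cases "0 \<in> B") (simp_all add: prob_space)
    next
      case False
      then have "0 < a" using a by simp
      let ?inc = "\<lambda>\<omega>. \<lambda>j\<in>{..<m}. X (a + v (Suc j)) \<omega> - X (a + v j) \<omega>"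
      have "prob {\<omega> \<in> space M. X a \<omega> \<in> B \<and> ?inc \<omega> \<in> S}
          = prob {\<omega> \<in> space M. X a \<omega> - X 0 \<omega> \<in> B \<and> ?inc \<omega> \<in> S}"
        using levy_processD(3)[OF levy] by (intro finite_measure_eq_AE) auto
      also have "\<dots> = prob {\<omega> \<in> space M. X a \<omega> - X 0 \<omega> \<in> B} * prob {\<omega> \<in> space M. ?inc \<omega> \<in> S}"
        by (rule levy_increments_indep[of M X a v m, OF levy \<open>0 < a\<close> v B S])
      also have "prob {\<omega> \<in> space M. X a \<omega> - X 0 \<omega> \<in> B} = prob {\<omega> \<in> space M. X a \<omega> \<in> B}"
        using levy_processD(3)[OF levy] by (intro finite_measure_eq_AE) auto
      also have "prob {\<omega> \<in> space M. ?inc \<omega> \<in> S}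
          = measure (distr M (PiM {..<m} (\<lambda>_. borel)) ?inc) S"
        by (simp add: measure_distr vimage_def Int_def conj_commute)
      also have "\<dots> = measure (distr M (PiM {..<m} (\<lambda>_. borel)) (\<lambda>\<omega>. \<lambda>j\<in>{..<m}. X (v (Suc j)) \<omega> - X (v j) \<omega>)) S"
        by (subst levy_increments_stationary[of M X a v m, OF levy a v]) auto
      also have "\<dots> = prob {\<omega> \<in> space M. (\<lambda>j\<in>{..<m}. X (v (Suc j)) \<omega> - X (v j) \<omega>) \<in> S}"
        by (simp add: measure_distr vimage_def Int_def conj_commute)
      finally show ?thesis .
    qed
  qed
  show ?thesis
  proof (rule pair_measure_eqI[symmetric])
    fix B C
    assume "B \<in> sets (distr M borel (X a))" and "C \<in> sets (distr M path_space (sample_path X))"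
    then have B [measurable]: "B \<in> sets borel" and C [measurable]: "C \<in> sets path_space" by simp_all
    \<comment> \<open>\<open>N1\<close> and \<open>N2\<close> are the two sides of the rectangle
      identity as measures in C, with B fixed.\<close>
    define N1 where "N1 = distr (density M (\<lambda>\<omega>. indicator B (X a \<omega>))) path_space (sample_path (\<lambda>u \<omega>. X (a + u) \<omega> - X a \<omega>))"
    define N2 where "N2 = scale_measure (ennreal (prob {\<omega> \<in> space M. X a \<omega> \<in> B})) (distr M path_space (sample_path X))"
    have N1: "emeasure N1 D = ennreal (prob {\<omega> \<in> space M. X a \<omega> \<in> B \<and> sample_path (\<lambda>u \<omega>. X (a + u) \<omega> - X a \<omega>) \<omega> \<in> D})"
      if [measurable]: "D \<in> sets path_space" for D
    proof -
      have "emeasure N1 D = (\<integral>\<^sup>+\<omega>. indicator B (X a \<omega>) * indicator D (sample_path (\<lambda>u \<omega>. X (a + u) \<omega> - X a \<omega>) \<omega>) \<partial>M)"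
        unfolding N1_def
        by (simp add: emeasure_distr emeasure_density)
          (auto intro!: nn_integral_cong simp: indicator_def)
      also have "\<dots> = (\<integral>\<^sup>+\<omega>. indicator {\<omega> \<in> space M. X a \<omega> \<in> B \<and> sample_path (\<lambda>u \<omega>. X (a + u) \<omega> - X a \<omega>) \<omega> \<in> D} \<omega> \<partial>M)"
        by (intro nn_integral_cong) (auto simp: indicator_def)
      finally show ?thesis by (simp add: emeasure_eq_measure)
    qed
    have N2: "emeasure N2 D = ennreal (prob {\<omega> \<in> space M. X a \<omega> \<in> B} * prob {\<omega> \<in> space M. sample_path X \<omega> \<in> D})"
      if [measurable]: "D \<in> sets path_space" for D
      unfolding N2_def
      by (simp add: emeasure_distr emeasure_eq_measure ennreal_mult vimage_def Int_def conj_commute)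
    have "N1 = N2"
    proof (rule measure_eqI_PiM_infinite)
      fix A :: "real \<Rightarrow> real set" and J :: "real set"
      assume J: "finite J" "J \<subseteq> {0..}" and A: "\<And>j. j \<in> J \<Longrightarrow> A j \<in> sets borel"
      have cyl: "sample_path Y \<omega> \<in> prod_emb {0..} (\<lambda>_. borel) J (Pi\<^sub>E J A) \<longleftrightarrow> (\<forall>j\<in>J. Y j \<omega> \<in> A j)"
        for Y :: "real \<Rightarrow> 'a \<Rightarrow> real" and \<omega>
        using J by (auto simp: prod_emb_iff PiE_iff subset_iff)
      have cyl_sets: "prod_emb {0..} (\<lambda>_. borel) J (Pi\<^sub>E J A) \<in> sets path_space"
        using J A by (auto intro!: sets_PiM_I)
      obtain m :: nat and v S where v: "v 0 = 0" "\<And>j. j < m \<Longrightarrow> v j < v (Suc j)"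
        and S: "S \<in> sets (PiM {..<m} (\<lambda>_. borel))"
        and iff: "\<And>(x::real \<Rightarrow> real) b. (\<forall>j\<in>J. x (b + j) - x b \<in> A j)
          \<longleftrightarrow> (\<lambda>j\<in>{..<m}. x (b + v (Suc j)) - x (b + v j)) \<in> S"
        by (rule finite_dim_set_via_increments[of J A, OF J A]) (assumption, rule that)
      \<comment> \<open>Subtracting X 0, which vanishes almost surely, turns values of the path into
        increments from 0.\<close>
      have law_X: "prob {\<omega> \<in> space M. sample_path X \<omega> \<in> prod_emb {0..} (\<lambda>_. borel) J (Pi\<^sub>E J A)}
          = prob {\<omega> \<in> space M. \<forall>j\<in>J. X (0 + j) \<omega> - X 0 \<omega> \<in> A j}"
      proof (rule finite_measure_eq_AE)
        show "AE \<omega> in M. \<omega> \<in> {\<omega> \<in> space M. sample_path X \<omega> \<in> prod_emb {0..} (\<lambda>_. borel) J (Pi\<^sub>E J A)}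
            \<longleftrightarrow> \<omega> \<in> {\<omega> \<in> space M. \<forall>j\<in>J. X (0 + j) \<omega> - X 0 \<omega> \<in> A j}"
          using levy_processD(3)[OF levy] by eventually_elim (simp add: cyl)
        show "{\<omega> \<in> space M. sample_path X \<omega> \<in> prod_emb {0..} (\<lambda>_. borel) J (Pi\<^sub>E J A)} \<in> events"
          using cyl_sets by measurable
        have "X j \<in> borel_measurable M" "A j \<in> sets borel" if "j \<in> J" for j using X J A that by auto
        then have "{\<omega> \<in> space M. X (0 + j) \<omega> - X 0 \<omega> \<in> A j} \<in> events" if "j \<in> J" for j
          using that X[of 0] by (intro pred_sets2[where N = borel, unfolded pred_def] borel_measurable_diff) auto
        then show "{\<omega> \<in> space M. \<forall>j\<in>J. X (0 + j) \<omega> - X 0 \<omega> \<in> A j} \<in> events"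
          using J(1) by (intro sets.sets_Collect_countable_All' countable_finite) auto
      qed
      show "emeasure N1 (prod_emb {0..} (\<lambda>_. borel) J (Pi\<^sub>E J A)) = emeasure N2 (prod_emb {0..} (\<lambda>_. borel) J (Pi\<^sub>E J A))"
      proof -
        have 1: "(\<forall>j\<in>J. X (a + j) \<omega> - X a \<omega> \<in> A j) \<longleftrightarrow> (\<lambda>j\<in>{..<m}. X (a + v (Suc j)) \<omega> - X (a + v j) \<omega>) \<in> S"
          and 2: "(\<forall>j\<in>J. X (0 + j) \<omega> - X 0 \<omega> \<in> A j) \<longleftrightarrow> (\<lambda>j\<in>{..<m}. X (0 + v (Suc j)) \<omega> - X (0 + v j) \<omega>) \<in> S" for \<omega>
          by (rule iff[of "\<lambda>u. X u \<omega>"])+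
        show ?thesis
          unfolding N1[OF cyl_sets] N2[OF cyl_sets] law_X 2
          unfolding cyl[of "\<lambda>u \<omega>. X (a + u) \<omega> - X a \<omega>"] 1 using indep[of v m B S, OF v B S] by simp
      qed
    next
      show "finite_measure N1"
      proof (rule finite_measureI)
        have "space N1 = space path_space" by (simp add: N1_def)
        then show "emeasure N1 (space N1) \<noteq> \<infinity>" using N1[OF sets.top] by simp
      qed
    qed (simp_all add: N1_def N2_def)
    then have "emeasure N1 C = emeasure N2 C" by simp
    moreover have "emeasure (distr M (borel \<Otimes>\<^sub>M path_space) (\<lambda>\<omega>. (X a \<omega>, sample_path (\<lambda>u \<omega>. X (a + u) \<omega> - X a \<omega>) \<omega>))) (B \<times> C)
        = emeasure N1 C"
      by (subst emeasure_distr) (auto simp: N1 emeasure_eq_measure intro!: arg_cong[where f = prob])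
    moreover have "emeasure (distr M borel (X a)) B * emeasure (distr M path_space (sample_path X)) C = emeasure N2 C"
      by (simp add: N2 emeasure_distr emeasure_eq_measure ennreal_mult vimage_def Int_def conj_commute)
    ultimately show "emeasure (distr M borel (X a)) B * emeasure (distr M path_space (sample_path X)) C
        = emeasure (distr M (borel \<Otimes>\<^sub>M path_space) (\<lambda>\<omega>. (X a \<omega>, sample_path (\<lambda>u \<omega>. X (a + u) \<omega> - X a \<omega>) \<omega>))) (B \<times> C)"
      by simp
  qed (use Xa.sigma_finite_measure_axioms pX.sigma_finite_measure_axioms in \<open>simp_all cong: sets_pair_measure_cong\<close>)
qed

section \<open>Measurable functionals of paths\<close>

text \<open>Since \<^const>\<open>path_space\<close> only sees countably many coordinates at a time, the functionals of a path
  needed below are expressed through its values at rational points.\<close>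

definition path_inverse :: "(real \<Rightarrow> real) \<Rightarrow> real \<Rightarrow> real" where
  "path_inverse d t = (if \<exists>q\<in>\<rat>. 0 < q \<and> t < d q then Inf {q\<in>\<rat>. 0 < q \<and> t < d q} else 0)"

text \<open>The m-th evaluation point is the first multiple of 1/(m+1) strictly to the right of u,
  hence within 1/(m+1) of u. Along these points a right-continuous path converges to its value at u,
  and each m involves only countably many coordinates.\<close>

definition path_eval :: "(real \<Rightarrow> real) \<Rightarrow> real \<Rightarrow> real" where
  "path_eval a u = lim (\<lambda>m. a (real (Suc (nat \<lfloor>real (Suc m) * u\<rfloor>)) / real (Suc m)))"

lemma measurable_path_inverse [measurable]:
  "(\<lambda>p. path_inverse (fst p) (snd p)) \<in> borel_measurable (path_space \<Otimes>\<^sub>M borel)"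
proof (rule borel_measurableI_less)
  fix y :: real
  let ?N = "path_space \<Otimes>\<^sub>M (borel :: real measure)"
  have gt [measurable]: "{p \<in> space ?N. \<exists>q\<in>{q\<in>\<rat>. 0 < q \<and> P q}. snd p < fst p q} \<in> sets ?N" for P :: "real \<Rightarrow> bool"
  proof (intro sets.sets_Collect_countable_Ex')
    show "countable {q \<in> \<rat>. 0 < q \<and> P q}"
      by (rule countable_subset[OF _ countable_rat]) auto
    fix q :: real assume "q \<in> {q \<in> \<rat>. 0 < q \<and> P q}"
    then have [measurable]: "(\<lambda>d. d q) \<in> borel_measurable path_space"
      by (intro measurable_component_singleton) auto
    show "{p \<in> space ?N. snd p < fst p q} \<in> sets ?N" by measurable
  qed
  \<comment> \<open>The second alternative is the default value 0, taken by a path that exceeds t at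
    no positive rational.\<close>
  have "path_inverse d t < y \<longleftrightarrow>
      (\<exists>q\<in>{q\<in>\<rat>. 0 < q \<and> q < y}. t < d q) \<or> (0 < y \<and> \<not> (\<exists>q\<in>{q\<in>\<rat>. 0 < q \<and> True}. t < d q))" for d t
  proof (cases "\<exists>q\<in>\<rat>. 0 < q \<and> t < d q")
    case True
    then have "{q\<in>\<rat>. 0 < q \<and> t < d q} \<noteq> {}" by auto
    moreover have "bdd_below {q\<in>\<rat>. 0 < q \<and> t < d q}" by (rule bdd_belowI[of _ 0]) auto
    ultimately show ?thesis
      using True unfolding path_inverse_def by (auto simp: cInf_less_iff)
  qed (auto simp: path_inverse_def)
  then have "{p \<in> space ?N. path_inverse (fst p) (snd p) < y} =
      {p \<in> space ?N. \<exists>q\<in>{q\<in>\<rat>. 0 < q \<and> q < y}. snd p < fst p q} \<union>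
      (if 0 < y then space ?N - {p \<in> space ?N. \<exists>q\<in>{q\<in>\<rat>. 0 < q \<and> True}. snd p < fst p q} else {})"
    by auto
  then show "{p \<in> space ?N. path_inverse (fst p) (snd p) < y} \<in> sets ?N"
    using gt[of "\<lambda>q. q < y"] gt[of "\<lambda>_. True"] by auto
qed

text \<open>With each point u the set {u > 0. D u > t} contains a right neighbourhood of u, by
  right-continuity, and therefore rationals arbitrarily close to u. So the real and the rational
  infimum agree, and the two sets are empty together, which matches the defaults.\<close>

lemma inverse_process_eq_path_inverse:
  assumes right_cont: "\<And>u. 0 < u \<Longrightarrow> ((\<lambda>v. D v \<omega>) \<longlongrightarrow> D u \<omega>) (at_right u)"
  shows "inverse_process D t \<omega> = path_inverse (sample_path D \<omega>) t"
proof -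
  define U where "U = {u. 0 < u \<and> t < D u \<omega>}"
  define Q where "Q = {q \<in> \<rat>. 0 < q \<and> t < D q \<omega>}"
  have dense: "\<exists>q\<in>Q. q < u + e" if u: "u \<in> U" and "e > 0" for u e
  proof -
    have "\<forall>\<^sub>F v in at_right u. t < D v \<omega>"
      using right_cont[of u] u by (intro order_tendstoD(1)) (auto simp: U_def)
    then obtain b where b: "u < b" "\<And>v. u < v \<Longrightarrow> v < b \<Longrightarrow> t < D v \<omega>"
      unfolding eventually_at_right_field by blast
    then have "u < min b (u + e)" using \<open>e > 0\<close> by simp
    then obtain q where "q \<in> \<rat>" "u < q" "q < min b (u + e)"
      using Rats_dense_in_real by blast
    then show ?thesis using b(2)[of q] u by (intro bexI[of _ q]) (auto simp: U_def Q_def)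
  qed
  have QU: "Q \<subseteq> U" by (auto simp: Q_def U_def)
  have bdd: "bdd_below U" "bdd_below Q" by (auto simp: U_def Q_def intro!: bdd_belowI[of _ 0])
  have "(if U \<noteq> {} then Inf U else 0) = (if Q \<noteq> {} then Inf Q else 0)"
  proof (cases "U = {}")
    case False
    then have Q: "Q \<noteq> {}" using dense[of _ 1] by auto
    have "Inf Q \<le> u" if "u \<in> U" for u
    proof (rule field_le_epsilon)
      fix e :: real assume "e > 0"
      then obtain q where "q \<in> Q" "q < u + e" using dense[OF \<open>u \<in> U\<close>] by auto
      then show "Inf Q \<le> u + e" using cInf_lower[OF _ bdd(2), of q] by simp
    qed
    then have "Inf Q \<le> Inf U" using False by (intro cInf_greatest)
    moreover have "Inf U \<le> Inf Q" using Q QU bdd by (intro cInf_superset_mono) auto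
    ultimately show ?thesis using False Q by simp
  qed (use QU in auto)
  moreover have "path_inverse (sample_path D \<omega>) t = (if Q \<noteq> {} then Inf Q else 0)"
  proof -
    have "Q = {q \<in> \<rat>. 0 < q \<and> t < sample_path D \<omega> q}" by (auto simp: Q_def)
    then show ?thesis unfolding path_inverse_def by auto
  qed
  moreover have "inverse_process D t \<omega> = (if U \<noteq> {} then Inf U else 0)"
    unfolding inverse_process_def U_def by auto
  ultimately show ?thesis by simp
qed

lemma measurable_inverse_process:
  assumes levy: "levy_process M D"
  shows "(\<lambda>p. inverse_process D (snd p) (fst p)) \<in> borel_measurable (M \<Otimes>\<^sub>M borel)"
proof -
  have [measurable]: "sample_path D \<in> M \<rightarrow>\<^sub>M path_space"
    using levy_processD(2)[OF levy] by (rule measurable_sample_path)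
  have "(\<lambda>p. (sample_path D (fst p), snd p)) \<in> M \<Otimes>\<^sub>M borel \<rightarrow>\<^sub>M path_space \<Otimes>\<^sub>M borel" by measurable
  from measurable_compose[OF this measurable_path_inverse]
  have "(\<lambda>p. path_inverse (sample_path D (fst p)) (snd p)) \<in> borel_measurable (M \<Otimes>\<^sub>M borel)" by simp
  moreover have "inverse_process D (snd p) (fst p) = path_inverse (sample_path D (fst p)) (snd p)"
    if "p \<in> space (M \<Otimes>\<^sub>M borel)" for p :: "'a \<times> real"
    using that levy_processD(6)[OF levy]
    by (intro inverse_process_eq_path_inverse) (auto simp: space_pair_measure)
  ultimately show ?thesis by (subst measurable_cong) auto
qed

lemma inverse_process_nonneg: "0 \<le> inverse_process D t \<omega>"
  unfolding inverse_process_def by (auto intro!: cInf_greatest)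

text \<open>For each m the grid index takes countably many values, and on each of them the
  evaluation is a single coordinate.\<close>

lemma measurable_path_eval [measurable]:
  "(\<lambda>p. path_eval (fst p) (snd p)) \<in> borel_measurable (path_space \<Otimes>\<^sub>M borel)"
  unfolding path_eval_def
proof (rule borel_measurable_lim_metric)
  fix m :: nat
  have 1: "(\<lambda>p. fst p (real (Suc k) / real (Suc m))) \<in> borel_measurable (path_space \<Otimes>\<^sub>M borel)" for k
    by (rule measurable_compose[OF measurable_fst measurable_component_singleton]) simp
  have 2: "(\<lambda>p. nat \<lfloor>real (Suc m) * snd p\<rfloor>) \<in> path_space \<Otimes>\<^sub>M borel \<rightarrow>\<^sub>M count_space UNIV"
    by measurable
  show "(\<lambda>p. fst p (real (Suc (nat \<lfloor>real (Suc m) * snd p\<rfloor>)) / real (Suc m))) \<in> borel_measurable (path_space \<Otimes>\<^sub>M borel)"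
    by (rule measurable_compose_countable[OF 1 2])
qed

lemma path_eval_sample_path:
  assumes right_cont: "((\<lambda>v. X v \<omega>) \<longlongrightarrow> X u \<omega>) (at_right u)" and u: "0 \<le> u"
  shows "path_eval (sample_path X \<omega>) u = X u \<omega>"
  unfolding path_eval_def
proof (rule limI)
  define g where "g m = real (Suc (nat \<lfloor>real (Suc m) * u\<rfloor>)) / real (Suc m)" for m
  have g: "u < g m" "g m \<le> u + 1 / real (Suc m)" for m
  proof -
    have "0 \<le> real (Suc m) * u" using u by simp
    then have "real (nat \<lfloor>real (Suc m) * u\<rfloor>) = real_of_int \<lfloor>real (Suc m) * u\<rfloor>" by simp
    then have "g m = (real_of_int \<lfloor>real (Suc m) * u\<rfloor> + 1) / real (Suc m)"
      by (simp add: g_def add.commute)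
    moreover have "(real_of_int \<lfloor>real (Suc m) * u\<rfloor> + 1) / real (Suc m) \<le> (real (Suc m) * u + 1) / real (Suc m)"
      by (intro divide_right_mono add_right_mono) (auto simp del: of_nat_Suc)
    moreover have "(real (Suc m) * u) / real (Suc m) < (real_of_int \<lfloor>real (Suc m) * u\<rfloor> + 1) / real (Suc m)"
      by (intro divide_strict_right_mono) (simp_all del: of_nat_Suc)
    ultimately show "u < g m" "g m \<le> u + 1 / real (Suc m)"
      by (simp_all add: add_divide_distrib del: of_nat_Suc)
  qed
  have "g \<longlonglongrightarrow> u"
  proof (rule tendsto_sandwich)
    show "\<forall>\<^sub>F m in sequentially. u \<le> g m" "\<forall>\<^sub>F m in sequentially. g m \<le> u + 1 / real (Suc m)"
      using g(1)[THEN less_imp_le] g(2) by (simp_all only: eventually_True)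
    show "(\<lambda>m. u + 1 / real (Suc m)) \<longlonglongrightarrow> u"
      using tendsto_add[OF tendsto_const LIMSEQ_inverse_real_of_nat, of u] by (simp add: inverse_eq_divide)
  qed simp
  then have "filterlim g (at_right u) sequentially"
    using g by (auto simp: filterlim_at intro!: always_eventually)
  from filterlim_compose[OF right_cont this]
  have "(\<lambda>m. X (g m) \<omega>) \<longlonglongrightarrow> X u \<omega>" .
  moreover have "sample_path X \<omega> (g m) = X (g m) \<omega>" for m
    using g[of m] u by simp
  ultimately show "(\<lambda>m. sample_path X \<omega> (real (Suc (nat \<lfloor>real (Suc m) * u\<rfloor>)) / real (Suc m))) \<longlonglongrightarrow> X u \<omega>"
    unfolding g_def[symmetric] by (simp only:)
qed

text \<open>As D a \<le> t, monotonicity places every passage above t beyond a, so the set of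
  passages is the a-translate of that of the restarted path. Unboundedness keeps the sets nonempty;
  the default value 0 would not translate.\<close>

lemma inverse_process_shift:
  assumes mono: "strict_mono_on {0..} (\<lambda>u. D u \<omega>)" and unbounded: "\<And>r. \<exists>u>0. r < D u \<omega>"
    and a: "0 \<le> a" and t: "D a \<omega> \<le> t"
  shows "inverse_process D t \<omega> = a + inverse_process (\<lambda>u \<omega>. D (a + u) \<omega> - D a \<omega>) (t - D a \<omega>) \<omega>"
proof -
  let ?S = "{v. 0 < v \<and> t < D (a + v) \<omega>}"
  have eq: "{u. 0 < u \<and> t < D u \<omega>} = (+) a ` ?S"
  proof (intro equalityI subsetI)
    fix u assume u: "u \<in> {u. 0 < u \<and> t < D u \<omega>}"
    have "a < u"
    proof (rule ccontr)
      assume "\<not> a < u"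
      then have "D u \<omega> \<le> D a \<omega>"
        using u a strict_mono_on_leD[OF mono, of u a] by auto
      then show False using u t by simp
    qed
    then show "u \<in> (+) a ` ?S" using u by (intro image_eqI[of _ _ "u - a"]) auto
  qed (use a in auto)
  obtain u where "0 < u" "t < D u \<omega>" using unbounded by blast
  then have S: "?S \<noteq> {}" using eq by blast
  have bdd: "bdd_below ?S" "bdd_below ((+) a ` ?S)"
    using a by (auto intro!: bdd_belowI[of _ 0])
  have "Inf ((+) a ` ?S) = a + Inf ?S"
  proof (rule antisym)
    have "Inf ((+) a ` ?S) - a \<le> v" if "v \<in> ?S" for v
      using cInf_lower[OF imageI[OF that] bdd(2)] by simp
    then have "Inf ((+) a ` ?S) - a \<le> Inf ?S" using S by (intro cInf_greatest)
    then show "Inf ((+) a ` ?S) \<le> a + Inf ?S" by simp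
    show "a + Inf ?S \<le> Inf ((+) a ` ?S)"
      using S by (intro cInf_greatest) (auto intro: cInf_lower[OF _ bdd(1)])
  qed
  then have "inverse_process D t \<omega> = a + Inf ?S"
    using \<open>0 < u\<close> \<open>t < D u \<omega>\<close> by (auto simp: inverse_process_def eq)
  then show ?thesis using S by (auto simp: inverse_process_def)
qed

text \<open>If D a < t, right-continuity keeps D below t for a while after a, which pushes the
  infimum strictly beyond a. If D a \<ge> t, strict monotonicity makes every u > a a passage above
  t, so the infimum is at most a.\<close>

lemma less_inverse_process_iff:
  assumes right_cont: "((\<lambda>v. D v \<omega>) \<longlongrightarrow> D a \<omega>) (at_right a)"
    and mono: "strict_mono_on {0..} (\<lambda>u. D u \<omega>)" and unbounded: "\<And>r. \<exists>u>0. r < D u \<omega>"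
    and a: "0 \<le> a"
  shows "a < inverse_process D t \<omega> \<longleftrightarrow> D a \<omega> < t"
proof -
  define U where "U = {u. 0 < u \<and> t < D u \<omega>}"
  have U: "U \<noteq> {}" "bdd_below U" using unbounded[of t] by (auto simp: U_def intro!: bdd_belowI[of _ 0])
  have E: "inverse_process D t \<omega> = Inf U"
    using unbounded[of t] by (auto simp: inverse_process_def U_def)
  show ?thesis
  proof
    assume "D a \<omega> < t"
    then have "\<forall>\<^sub>F v in at_right a. D v \<omega> < t"
      using right_cont by (intro order_tendstoD(2))
    then obtain b where b: "a < b" "\<And>v. a < v \<Longrightarrow> v < b \<Longrightarrow> D v \<omega> < t"
      unfolding eventually_at_right_field by blast
    \<comment> \<open>The midpoint, because the bound on D holds only strictly before b.\<close>
    have "(a + b) / 2 \<le> u" if "u \<in> U" for u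
    proof (rule ccontr)
      assume "\<not> (a + b) / 2 \<le> u"
      then have "D u \<omega> \<le> D ((a + b) / 2) \<omega>"
        using that a b(1) strict_mono_on_leD[OF mono, of u "(a + b) / 2"] by (auto simp: U_def)
      moreover have "D ((a + b) / 2) \<omega> < t" using b by (intro b(2)) auto
      ultimately show False using that by (simp add: U_def)
    qed
    then have "(a + b) / 2 \<le> Inf U" using U by (intro cInf_greatest)
    then show "a < inverse_process D t \<omega>" unfolding E using \<open>a < b\<close> by simp
  next
    assume "a < inverse_process D t \<omega>"
    show "D a \<omega> < t"
    proof (rule ccontr)
      assume "\<not> D a \<omega> < t"
      have "Inf U \<le> u" if "a < u" for u
      proof (rule cInf_lower[OF _ U(2)])
        have "D a \<omega> < D u \<omega>" using mono a that by (auto simp: strict_mono_on_def)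
        then show "u \<in> U" using \<open>\<not> D a \<omega> < t\<close> a that by (simp add: U_def)
      qed
      then have "Inf U \<le> a" by (rule dense_ge)
      then show False using \<open>a < inverse_process D t \<omega>\<close> E by simp
    qed
  qed
qed

lemma mono_inverse_process:
  assumes unbounded: "\<And>r. \<exists>u>0. r < D u \<omega>" and "t \<le> t'"
  shows "inverse_process D t \<omega> \<le> inverse_process D t' \<omega>"
proof -
  have "Inf {u. 0 < u \<and> t < D u \<omega>} \<le> Inf {u. 0 < u \<and> t' < D u \<omega>}"
    using unbounded[of t'] \<open>t \<le> t'\<close> by (intro cInf_superset_mono) (auto intro!: bdd_belowI[of _ 0])
  then show ?thesis using unbounded by (simp add: inverse_process_def)
qed

lemma distr_PiM_lborel_translate:
  assumes "finite I"
  shows "distr (PiM I (\<lambda>_. lborel)) (PiM I (\<lambda>_. lborel)) (\<lambda>t. \<lambda>i\<in>I. t i + c) = PiM I (\<lambda>_. lborel :: real measure)"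
proof -
  interpret product_sigma_finite "\<lambda>_. lborel :: real measure" ..
  have [measurable]: "(\<lambda>t. \<lambda>i\<in>I. t i + c) \<in> PiM I (\<lambda>_. lborel) \<rightarrow>\<^sub>M PiM I (\<lambda>_. lborel :: real measure)"
    by (intro measurable_restrict borel_measurable_add) (auto intro!: measurable_component_singleton)
  show ?thesis
  proof (rule PiM_eqI[OF assms])
    fix A :: "'a \<Rightarrow> real set" assume A: "\<And>i. i \<in> I \<Longrightarrow> A i \<in> sets lborel"
    let ?A = "\<lambda>i. (+) c -` A i"
    have A': "?A i \<in> sets lborel" if "i \<in> I" for i
      using measurable_sets[of "(+) c" borel borel "A i"] A[OF that] by simp
    have "(\<lambda>t. \<lambda>i\<in>I. t i + c) -` Pi\<^sub>E I A \<inter> space (PiM I (\<lambda>_. lborel)) = Pi\<^sub>E I ?A"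
      by (auto simp: space_PiM PiE_iff add.commute extensional_def)
    then have "emeasure (distr (PiM I (\<lambda>_. lborel)) (PiM I (\<lambda>_. lborel)) (\<lambda>t. \<lambda>i\<in>I. t i + c)) (Pi\<^sub>E I A)
        = emeasure (PiM I (\<lambda>_. lborel)) (Pi\<^sub>E I ?A)"
      using A assms by (subst emeasure_distr) (auto intro!: sets_PiM_I_finite)
    also have "\<dots> = (\<Prod>i\<in>I. emeasure lborel (?A i))"
      using A' assms by (intro emeasure_PiM) auto
    also have "\<dots> = (\<Prod>i\<in>I. emeasure lborel (A i))"
    proof (rule prod.cong[OF refl])
      fix i assume "i \<in> I"
      have "emeasure lborel (A i) = emeasure (distr lborel borel ((+) c)) (A i)"
        by (simp add: lborel_distr_plus)
      also have "\<dots> = emeasure lborel (?A i)"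
        using A[OF \<open>i \<in> I\<close>] by (subst emeasure_distr) auto
      finally show "emeasure lborel (?A i) = emeasure lborel (A i)" by simp
    qed
    finally show "emeasure (distr (PiM I (\<lambda>_. lborel)) (PiM I (\<lambda>_. lborel)) (\<lambda>t. \<lambda>i\<in>I. t i + c)) (Pi\<^sub>E I A)
        = (\<Prod>i\<in>I. emeasure lborel (A i))" .
  qed simp
qed

section \<open>The renewal identity\<close>

lemma ordered_times_pos:
  assumes "ordered_times n t" "i \<in> {1..n}"
  shows "0 < t 1" "t 1 \<le> t i"
proof -
  show "0 < t 1" using assms by (simp add: ordered_times_def)
  from assms(2) have "1 \<le> i" "i \<le> n" by auto
  then show "t 1 \<le> t i"
  proof (induction i rule: dec_induct)
    case (step j)
    then have "t j < t (Suc j)" using assms(1) by (simp add: ordered_times_def)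
    then show ?case using step by simp
  qed simp
qed

lemma ordered_times_mono:
  assumes "ordered_times n t" "1 \<le> i" "i \<le> j" "j \<le> n"
  shows "t i \<le> t j"
  using \<open>i \<le> j\<close> \<open>j \<le> n\<close>
proof (induction j rule: dec_induct)
  case (step j)
  then have "t j < t (Suc j)" using assms by (simp add: ordered_times_def)
  then show ?case using step by simp
qed simp

lemma nn_integral_exp_greaterThan:
  fixes c x :: real
  assumes "c < 0"
  shows "(\<integral>\<^sup>+u. ennreal (exp (c * u)) * indicator {x<..} u \<partial>lborel) = ennreal (exp (c * x) / - c)"
proof -
  have "(\<integral>\<^sup>+u. ennreal (exp (c * u)) * indicator {x<..} u \<partial>lborel) = (\<integral>\<^sup>+u. ennreal (exp (c * u)) * indicator {x..} u \<partial>lborel)"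
    by (intro nn_integral_cong_AE eventually_mono[OF AE_lborel_singleton[of x]]) (auto simp: indicator_def)
  also have "\<dots> = ennreal (0 - exp (c * x) / c)"
  proof (rule nn_integral_FTC_atLeast)
    have "filterlim (\<lambda>u. c * u) at_bot at_top"
      using assms by (intro filterlim_tendsto_neg_mult_at_bot[OF tendsto_const]) (auto simp: filterlim_ident)
    then have "((\<lambda>u. exp (c * u)) \<longlongrightarrow> 0) at_top" by (rule filterlim_compose[OF exp_at_bot])
    then show "((\<lambda>u. exp (c * u) / c) \<longlongrightarrow> 0) at_top"
      using tendsto_divide[of _ 0 at_top "\<lambda>_. c" c] assms by auto
    show "((\<lambda>u. exp (c * u) / c) has_real_derivative exp (c * u)) (at u)" for u
      using assms by (auto intro!: derivative_eq_intros)
  qed auto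
  finally show ?thesis by simp
qed

text \<open>The vector \<open>s\<close> is fixed throughout, so \<open>\<phi>\<close> is a number:
  the value of the Laplace exponent at the sum of the \<open>s i\<close>.\<close>

locale inverse_subordinator = prob_space M for M :: "'a measure" +
  fixes D :: "real \<Rightarrow> 'a \<Rightarrow> real" and n :: nat and s :: "nat \<Rightarrow> real" and \<phi> :: real
  assumes levy: "levy_process M D"
    and strict: "strictly_increasing M D"
    and n: "1 \<le> n"
    and s_pos: "\<And>i. i \<in> {1..n} \<Longrightarrow> 0 < s i"
    and laplace: "\<And>u. 0 \<le> u \<Longrightarrow> (LINT \<omega>|M. exp (- (\<Sum>i\<in>{1..n}. s i) * D u \<omega>)) = exp (u * \<phi>)"
begin

definition idx :: "nat set" where "idx = {1..n}"

definition idx2 :: "nat set" where "idx2 = {2..n}"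

lemma idx [simp]: "finite idx" "finite idx2" "Suc 0 \<in> idx" "i \<in> idx2 \<Longrightarrow> i \<in> idx"
  using n by (auto simp: idx_def idx2_def)

abbreviation (input) E :: "real \<Rightarrow> 'a \<Rightarrow> real" where "E \<equiv> inverse_process D"

definition S :: real where "S = (\<Sum>i\<in>idx. s i)"

abbreviation times :: "(nat \<Rightarrow> real) measure" where "times \<equiv> PiM idx (\<lambda>_. lborel)"

abbreviation vecs :: "(nat \<Rightarrow> real) measure" where "vecs \<equiv> PiM idx2 (\<lambda>_. borel)"

text \<open>Being 0 off the ordered times, it absorbs the convention that the laws vanish
  there.\<close>

definition weight :: "(nat \<Rightarrow> real) \<Rightarrow> ennreal" where
  "weight t = (if ordered_times n t then ennreal (exp (- (\<Sum>i\<in>idx. s i * t i))) else 0)"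

definition increments :: "(nat \<Rightarrow> real) \<Rightarrow> 'a \<Rightarrow> nat \<Rightarrow> real" where
  "increments t \<omega> = (\<lambda>i\<in>idx2. E (t i) \<omega> - E (t 1) \<omega>)"

text \<open>Image of a single measure on the product of M and the times, so that Fubini permits
  integrating first over the times, as the renewal argument does, or first over M, as the transforms
  do.\<close>

definition G :: "(real \<times> (nat \<Rightarrow> real)) measure" where
  "G = distr (density (M \<Otimes>\<^sub>M times) (\<lambda>p. weight (snd p))) (borel \<Otimes>\<^sub>M vecs)
     (\<lambda>p. (E (snd p 1) (fst p), increments (snd p) (fst p)))"

text \<open>The constant undoes the total mass 1/(-\<phi>) of exp(\<phi> u) du on (0,\<infinity>),
  by which the second marginal of \<open>G\<close> differs from the boundary measure.\<close>

definition h0 :: "(nat \<Rightarrow> real) measure" where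
  "h0 = density (distr G vecs snd) (\<lambda>_. ennreal (- \<phi>))"

definition exp_measure :: "real measure" where
  "exp_measure = density lborel (\<lambda>u. ennreal (exp (\<phi> * u)) * indicator {0<..} u)"

lemma S_pos: "0 < S"
  unfolding S_def idx_def using s_pos n by (intro sum_pos) auto

lemma sigma_finite_times: "sigma_finite_measure times"
proof -
  interpret product_sigma_finite "\<lambda>_::nat. lborel :: real measure" ..
  show ?thesis by (rule sigma_finite) simp
qed

section \<open>Laplace transform and path properties of the subordinator\<close>

lemma D_meas: "0 \<le> u \<Longrightarrow> D u \<in> borel_measurable M"
  by (rule levy_processD(2)[OF levy])

lemma AE_D_nonneg: "AE \<omega> in M. \<forall>u\<ge>0. 0 \<le> D u \<omega>"
  using levy_processD(3)[OF levy] strict[unfolded strictly_increasing_def]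
proof eventually_elim
  case (elim \<omega>)
  then show ?case using strict_mono_on_leD[OF elim(2), of 0] by auto
qed

lemma laplace_S: "0 \<le> u \<Longrightarrow> (LINT \<omega>|M. exp (- S * D u \<omega>)) = exp (u * \<phi>)"
  unfolding S_def idx_def by (rule laplace)

text \<open>A function that is not integrable has integral 0 by convention, but the value here is an
  exponential.\<close>

lemma laplace_integrable: "0 \<le> u \<Longrightarrow> integrable M (\<lambda>\<omega>. exp (- S * D u \<omega>))"
  using laplace_S[of u] not_integrable_integral_eq by fastforce

lemma nn_laplace:
  assumes "0 \<le> u"
  shows "(\<integral>\<^sup>+\<omega>. ennreal (exp (- S * D u \<omega>)) \<partial>M) = ennreal (exp (u * \<phi>))"
  by (subst nn_integral_eq_integral[OF laplace_integrable[OF assms]]) (simp_all add: laplace_S[simplified] assms)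

text \<open>Strict increase gives D 1 > 0 and hence exp(-S D_1) < 1 almost surely, so its mean
  exp(\<phi>) is below 1. This is the decay rate that makes all integrals over E_1 converge.\<close>

lemma \<phi>_neg: "\<phi> < 0"
proof (rule ccontr)
  assume "\<not> \<phi> < 0"
  have int: "integrable M (\<lambda>\<omega>. 1 - exp (- S * D 1 \<omega>))"
    using laplace_integrable[of 1] by simp
  have pos: "AE \<omega> in M. 0 < 1 - exp (- S * D 1 \<omega>)"
    using levy_processD(3)[OF levy] strict[unfolded strictly_increasing_def]
  proof eventually_elim
    case (elim \<omega>)
    then have "0 < D 1 \<omega>" using strict_mono_onD[OF elim(2), of 0 1] by simp
    then show ?case using S_pos by simp
  qed
  have "(\<integral>\<omega>. 1 - exp (- S * D 1 \<omega>) \<partial>M) = 1 - exp \<phi>"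
    using laplace_integrable[of 1] laplace_S[of 1] by (simp add: prob_space)
  moreover have "0 \<le> (\<integral>\<omega>. 1 - exp (- S * D 1 \<omega>) \<partial>M)"
    using pos by (intro integral_nonneg_AE) (auto elim: eventually_mono)
  ultimately have "(\<integral>\<omega>. 1 - exp (- S * D 1 \<omega>) \<partial>M) = 0"
    using \<open>\<not> \<phi> < 0\<close> by (intro antisym) auto
  moreover have "AE \<omega> in M. 0 \<le> 1 - exp (- S * D 1 \<omega>)" using pos by (auto elim: eventually_mono)
  ultimately have "AE \<omega> in M. 1 - exp (- S * D 1 \<omega>) = 0"
    using integral_nonneg_eq_0_iff_AE[OF int] by blast
  with pos have "AE \<omega> in M. False" by eventually_elim linarith
  then show False by simp
qed

text \<open>The means exp(m \<phi>) of exp(-S D_m) tend to 0, so the infimum of these variables over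
  m is almost surely 0. This keeps the default value of \<open>inverse_process\<close> out of the
  argument.\<close>

lemma AE_unbounded: "AE \<omega> in M. \<forall>r. \<exists>u>0. r < D u \<omega>"
proof -
  let ?f = "\<lambda>m \<omega>. ennreal (exp (- S * D (real (Suc m)) \<omega>))"
  have [measurable]: "D (real (Suc m)) \<in> borel_measurable M" for m by (rule D_meas) simp
  have "(\<integral>\<^sup>+\<omega>. (INF m. ?f m \<omega>) \<partial>M) \<le> ennreal (exp (real (Suc m) * \<phi>))" for m
  proof -
    have "(\<integral>\<^sup>+\<omega>. (INF m. ?f m \<omega>) \<partial>M) \<le> (\<integral>\<^sup>+\<omega>. ?f m \<omega> \<partial>M)"
      by (intro nn_integral_mono INF_lower) simp
    then show ?thesis using nn_laplace[of "real (Suc m)"] by simp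
  qed
  moreover have "(\<lambda>m. ennreal (exp (real (Suc m) * \<phi>))) \<longlonglongrightarrow> ennreal 0"
  proof (intro tendsto_ennrealI filterlim_compose[OF exp_at_bot])
    have "filterlim (\<lambda>m. real m * \<phi>) at_bot sequentially"
      using filterlim_tendsto_neg_mult_at_bot[OF tendsto_const \<phi>_neg filterlim_real_sequentially]
      by (simp add: mult.commute)
    then show "filterlim (\<lambda>m. real (Suc m) * \<phi>) at_bot sequentially"
      by (rule filterlim_compose[OF _ filterlim_Suc])
  qed
  ultimately have "(\<integral>\<^sup>+\<omega>. (INF m. ?f m \<omega>) \<partial>M) \<le> ennreal 0"
    by (intro LIMSEQ_le_const[where X = "\<lambda>m. ennreal (exp (real (Suc m) * \<phi>))"]) blast+
  then have "(\<integral>\<^sup>+\<omega>. (INF m. ?f m \<omega>) \<partial>M) = 0" by simp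
  moreover have "(\<lambda>\<omega>. INF m. ?f m \<omega>) \<in> borel_measurable M" by measurable
  ultimately have "AE \<omega> in M. (INF m. ?f m \<omega>) = 0"
    using nn_integral_0_iff_AE by blast
  then show ?thesis
  proof eventually_elim
    case (elim \<omega>)
    show ?case
    proof
      fix r
      have "(INF m. ?f m \<omega>) < ennreal (exp (- S * r))" using elim by simp
      then obtain m where "?f m \<omega> < ennreal (exp (- S * r))" unfolding INF_less_iff by blast
      then have "S * r < S * D (real (Suc m)) \<omega>" by (simp add: ennreal_less_iff)
      then have "r < D (real (Suc m)) \<omega>" using S_pos by simp
      then show "\<exists>u>0. r < D u \<omega>" by (intro exI[of _ "real (Suc m)"]) simp
    qed
  qed
qed

lemma AE_good: "AE \<omega> in M. D 0 \<omega> = 0 \<and> strict_mono_on {0..} (\<lambda>u. D u \<omega>) \<and> (\<forall>r. \<exists>u>0. r < D u \<omega>) \<and> (\<forall>u\<ge>0. 0 \<le> D u \<omega>)"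
  using levy_processD(3)[OF levy] strict[unfolded strictly_increasing_def] AE_unbounded AE_D_nonneg
  by eventually_elim blast

section \<open>Measurability and finiteness of the weighted law\<close>

lemma measurable_E [measurable]: "i \<in> idx \<Longrightarrow> (\<lambda>p. E (snd p i) (fst p)) \<in> borel_measurable (M \<Otimes>\<^sub>M times)"
  by (rule measurable_compose[OF _ measurable_inverse_process[OF levy], of "\<lambda>p. (fst p, snd p i)", simplified])
    (intro measurable_Pair measurable_fst measurable_compose[OF measurable_snd], simp)

lemma measurable_ordered_times [measurable]: "Measurable.pred times (ordered_times n)"
proof -
  have meas [measurable]: "(\<lambda>t. t i) \<in> borel_measurable times" if "i \<in> idx" for i
    using measurable_component_singleton[OF that, of "\<lambda>_. lborel"] by simp
  have "{t \<in> space times. 0 < t 1 \<and> (\<forall>i\<in>{1..<n}. t i < t (Suc i))} \<in> sets times"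
  proof (intro sets.sets_Collect_conj sets.sets_Collect_countable_All' countable_finite)
    show "{t \<in> space times. 0 < t 1} \<in> sets times" by measurable
    show "{t \<in> space times. t i < t (Suc i)} \<in> sets times" if "i \<in> {1..<n}" for i
    proof -
      have [measurable]: "(\<lambda>t. t i) \<in> borel_measurable times" "(\<lambda>t. t (Suc i)) \<in> borel_measurable times"
        using that by (auto intro!: meas) (auto simp: idx_def)
      show ?thesis by measurable
    qed
  qed simp
  then show ?thesis by (simp add: pred_def ordered_times_def)
qed

lemma measurable_weight [measurable]: "weight \<in> borel_measurable times"
proof -
  have [measurable]: "(\<lambda>t. t i) \<in> borel_measurable times" if "i \<in> idx" for i
    using measurable_component_singleton[OF that, of "\<lambda>_. lborel"] by simp
  show ?thesis unfolding weight_def by measurable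
qed

lemma measurable_increments [measurable]: "(\<lambda>p. increments (snd p) (fst p)) \<in> M \<Otimes>\<^sub>M times \<rightarrow>\<^sub>M vecs"
  unfolding increments_def using n by (intro measurable_restrict borel_measurable_diff measurable_E) auto

lemma sets_G [measurable_cong]: "sets G = sets (borel \<Otimes>\<^sub>M vecs)"
  by (simp add: G_def)

lemma nn_integral_pair_weight:
  assumes [measurable]: "f \<in> borel_measurable (M \<Otimes>\<^sub>M times)"
  shows "(\<integral>\<^sup>+p. f p \<partial>density (M \<Otimes>\<^sub>M times) (\<lambda>p. weight (snd p)))
    = (\<integral>\<^sup>+\<omega>. \<integral>\<^sup>+t. weight t * f (\<omega>, t) \<partial>times \<partial>M)"
proof -
  interpret times: sigma_finite_measure times by (rule sigma_finite_times)
  have "(\<integral>\<^sup>+p. f p \<partial>density (M \<Otimes>\<^sub>M times) (\<lambda>p. weight (snd p))) = (\<integral>\<^sup>+p. weight (snd p) * f p \<partial>(M \<Otimes>\<^sub>M times))"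
    by (subst nn_integral_density) auto
  also have "\<dots> = (\<integral>\<^sup>+\<omega>. \<integral>\<^sup>+t. weight t * f (\<omega>, t) \<partial>times \<partial>M)"
    by (subst times.nn_integral_fst[symmetric]) auto
  finally show ?thesis .
qed

lemma nn_integral_G:
  assumes [measurable]: "f \<in> borel_measurable (borel \<Otimes>\<^sub>M vecs)"
  shows "(\<integral>\<^sup>+q. f q \<partial>G) = (\<integral>\<^sup>+\<omega>. \<integral>\<^sup>+t. weight t * f (E (t 1) \<omega>, increments t \<omega>) \<partial>times \<partial>M)"
proof -
  have [measurable]: "(\<lambda>p. E (snd p 1) (fst p)) \<in> borel_measurable (M \<Otimes>\<^sub>M times)"
    using n by (intro measurable_E) simp
  show ?thesis
    unfolding G_def by (subst nn_integral_distr, simp, simp, subst nn_integral_pair_weight) auto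
qed

text \<open>Dropping the ordering leaves a product of exponential integrals over the positive
  orthant, with value the product of the 1/s_i.\<close>

lemma nn_integral_weight: "(\<integral>\<^sup>+t. weight t \<partial>times) < \<infinity>"
proof -
  interpret product_sigma_finite "\<lambda>_::nat. lborel :: real measure" ..
  have "(\<integral>\<^sup>+t. weight t \<partial>times) \<le> (\<integral>\<^sup>+t. (\<Prod>i\<in>idx. ennreal (exp (- s i * t i)) * indicator {0<..} (t i)) \<partial>times)"
  proof (rule nn_integral_mono)
    fix t :: "nat \<Rightarrow> real"
    show "weight t \<le> (\<Prod>i\<in>idx. ennreal (exp (- s i * t i)) * indicator {0<..} (t i))"
    proof (cases "ordered_times n t")
      case True
      have "(\<Prod>i\<in>idx. ennreal (exp (- s i * t i)) * indicator {0<..} (t i)) = (\<Prod>i\<in>idx. ennreal (exp (- s i * t i)))"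
      proof (rule prod.cong)
        fix i assume "i \<in> idx"
        then have "0 < t i" using ordered_times_pos[OF True, of i, folded idx_def] by linarith
        then show "ennreal (exp (- s i * t i)) * indicator {0<..} (t i) = ennreal (exp (- s i * t i))" by simp
      qed simp
      also have "\<dots> = ennreal (exp (- (\<Sum>i\<in>idx. s i * t i)))"
        by (simp add: prod_ennreal exp_sum flip: sum_negf)
      finally show ?thesis using True by (simp add: weight_def)
    qed (simp add: weight_def)
  qed
  also have "\<dots> = (\<Prod>i\<in>idx. \<integral>\<^sup>+x. ennreal (exp (- s i * x)) * indicator {0<..} x \<partial>lborel)"
    by (subst product_nn_integral_prod[symmetric]) auto
  also have "\<dots> = (\<Prod>i\<in>idx. ennreal (exp (- s i * 0) / - (- s i)))"
    using s_pos[folded idx_def] by (intro prod.cong refl nn_integral_exp_greaterThan) auto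
  also have "\<dots> < \<infinity>" by (simp add: ennreal_prod_eq_top less_top[symmetric])
  finally show ?thesis .
qed

lemma finite_measure_G: "finite_measure G"
proof (rule finite_measureI)
  have "emeasure G (space G) = (\<integral>\<^sup>+q. 1 \<partial>G)" by simp
  also have "\<dots> = (\<integral>\<^sup>+t. weight t \<partial>times)" by (subst nn_integral_G) (simp_all add: emeasure_space_1)
  finally show "emeasure G (space G) \<noteq> \<infinity>" using nn_integral_weight by simp
qed

section \<open>Restarting the subordinator at a fixed level\<close>

abbreviation (input) D_shift :: "real \<Rightarrow> real \<Rightarrow> 'a \<Rightarrow> real" where
  "D_shift a \<equiv> \<lambda>u \<omega>. D (a + u) \<omega> - D a \<omega>"

text \<open>\<open>increments\<close> as a function of the path alone, so that it can also be
  applied to the restarted path.\<close>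

definition path_increments :: "(nat \<Rightarrow> real) \<Rightarrow> (real \<Rightarrow> real) \<Rightarrow> nat \<Rightarrow> real" where
  "path_increments t d = (\<lambda>i\<in>idx2. path_inverse d (t i) - path_inverse d (t 1))"

lemma measurable_path_increments [measurable]:
  "(\<lambda>p. path_increments (snd p) (fst p)) \<in> path_space \<Otimes>\<^sub>M times \<rightarrow>\<^sub>M vecs"
proof -
  have "(\<lambda>p. path_inverse (fst p) (snd p i)) \<in> borel_measurable (path_space \<Otimes>\<^sub>M times)" if "i \<in> idx" for i
    by (rule measurable_compose[OF _ measurable_path_inverse, of "\<lambda>p. (fst p, snd p i)", simplified])
      (use that in \<open>intro measurable_Pair measurable_fst measurable_compose[OF measurable_snd], simp\<close>)
  then show ?thesis
    unfolding path_increments_def by (intro measurable_restrict borel_measurable_diff) auto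
qed

lemma E_eq_path_inverse:
  "\<omega> \<in> space M \<Longrightarrow> E r \<omega> = path_inverse (sample_path D \<omega>) r"
  using levy_processD(6)[OF levy] by (intro inverse_process_eq_path_inverse) auto

lemma increments_eq_path_increments:
  "\<omega> \<in> space M \<Longrightarrow> increments t \<omega> = path_increments t (sample_path D \<omega>)"
  by (simp add: increments_def path_increments_def E_eq_path_inverse)

text \<open>The renewal step for a single path. With t_i = \<tau>_i + D_a the condition E(t_1) > a
  becomes \<tau>_1 > 0, which \<open>weight \<tau>\<close> contains already; all E(t_i) lose the
  same summand a, and the exponential weight yields exp(-S D_a).\<close>

lemma translate_integrand:
  assumes \<omega>: "\<omega> \<in> space M" "D 0 \<omega> = 0" "strict_mono_on {0..} (\<lambda>u. D u \<omega>)" "\<forall>r. \<exists>u>0. r < D u \<omega>"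
      "\<forall>u\<ge>0. 0 \<le> D u \<omega>"
    and a: "0 \<le> a"
  shows "weight (\<lambda>i\<in>idx. \<tau> i + D a \<omega>) * (indicator {a<..} (E ((\<lambda>i\<in>idx. \<tau> i + D a \<omega>) 1) \<omega>)
            * indicator B (increments (\<lambda>i\<in>idx. \<tau> i + D a \<omega>) \<omega>))
    = ennreal (exp (- S * D a \<omega>)) * (weight \<tau> * indicator B (path_increments \<tau> (sample_path (D_shift a) \<omega>)))"
proof -
  let ?c = "D a \<omega>" and ?t = "\<lambda>i\<in>idx. \<tau> i + D a \<omega>"
  have c: "0 \<le> ?c" using \<omega> a by auto
  have less: "a < E r \<omega> \<longleftrightarrow> ?c < r" for r
    using \<omega> a levy_processD(6)[OF levy \<omega>(1) a] by (intro less_inverse_process_iff) auto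
  have t1: "?t 1 = \<tau> 1 + ?c" by simp
  show ?thesis
  proof (cases "0 < \<tau> 1")
    \<comment> \<open>Both sides vanish: the left one through the indicator, since t_1 \<le> D_a,
      and the right one through the weight.\<close>
    case False
    then have "\<not> ordered_times n \<tau>" by (simp add: ordered_times_def)
    then show ?thesis using False less[of "?t 1"] t1 by (simp add: weight_def)
  next
    case True
    \<comment> \<open>Only the condition on the first time is affected by translation, and it holds
      on both sides because \<tau>_1 > 0 and D_a \<ge> 0.\<close>
    have ord: "ordered_times n ?t \<longleftrightarrow> ordered_times n \<tau>"
      using True c n by (auto simp: ordered_times_def idx_def)
    show ?thesis
    proof (cases "ordered_times n \<tau>")
      case False
      then show ?thesis using ord by (simp add: weight_def)
    next
      case ordered: True
      have exp_eq: "exp (- (\<Sum>i\<in>idx. s i * ?t i)) = exp (- S * ?c) * exp (- (\<Sum>i\<in>idx. s i * \<tau> i))"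
      proof -
        have "(\<Sum>i\<in>idx. s i * ?t i) = (\<Sum>i\<in>idx. s i * \<tau> i) + S * ?c"
          by (simp add: S_def sum.distrib distrib_left sum_distrib_right)
        then show ?thesis by (simp add: exp_add[symmetric] algebra_simps)
      qed
      have E_shift: "E (?t i) \<omega> = a + path_inverse (sample_path (D_shift a) \<omega>) (\<tau> i)" if "i \<in> idx" for i
      proof -
        have "0 \<le> \<tau> i" using ordered_times_pos[OF ordered, of i] that by (simp add: idx_def)
        then have "E (?t i) \<omega> = a + inverse_process (D_shift a) (?t i - ?c) \<omega>"
          using \<omega> a that by (intro inverse_process_shift) auto
        also have "?t i - ?c = \<tau> i" using that by simp
        also have "inverse_process (D_shift a) (\<tau> i) \<omega> = path_inverse (sample_path (D_shift a) \<omega>) (\<tau> i)"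
        proof (rule inverse_process_eq_path_inverse)
          fix u :: real assume "0 < u"
          then have "((\<lambda>v. D v \<omega>) \<longlongrightarrow> D (a + u) \<omega>) (at_right (a + u))"
            using a by (intro levy_processD(6)[OF levy \<omega>(1)]) auto
          moreover have "filterlim (\<lambda>v. a + v) (at_right (a + u)) (at_right u)"
            by (auto simp: filterlim_at eventually_at_filter intro!: tendsto_intros)
          ultimately have "((\<lambda>v. D (a + v) \<omega>) \<longlongrightarrow> D (a + u) \<omega>) (at_right u)"
            by (rule filterlim_compose)
          then show "((\<lambda>v. D_shift a v \<omega>) \<longlongrightarrow> D_shift a u \<omega>) (at_right u)"
            by (intro tendsto_diff tendsto_const)
        qed
        finally show ?thesis .
      qed
      have "increments ?t \<omega> = path_increments \<tau> (sample_path (D_shift a) \<omega>)"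
        unfolding increments_def path_increments_def
        using E_shift[of 1] by (intro restrict_ext) (simp add: E_shift del: restrict_apply)
      moreover have "a < E (?t 1) \<omega>" using less[of "?t 1"] True t1 by simp
      moreover have "weight ?t = ennreal (exp (- S * ?c)) * weight \<tau>"
        unfolding weight_def using ord ordered exp_eq by (simp add: ennreal_mult[symmetric] del: restrict_apply)
      ultimately show ?thesis by (simp add: mult_ac del: restrict_apply)
    qed
  qed
qed

text \<open>Up to null sets \<open>{E (t 1) > a} = {t 1 > D a}\<close>, and after time \<open>D a\<close>
  the process starts afresh.\<close>

lemma renewal:
  assumes B [measurable]: "B \<in> sets vecs" and a: "0 \<le> a"
  shows "emeasure G ({a<..} \<times> B) = ennreal (exp (a * \<phi>)) * emeasure G (UNIV \<times> B)"
proof -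
  interpret times: sigma_finite_measure times by (rule sigma_finite_times)
  note [measurable] = D_meas[OF a]
  have shift_meas [measurable]: "sample_path (D_shift a) \<in> M \<rightarrow>\<^sub>M path_space"
    using a by (intro measurable_sample_path borel_measurable_diff D_meas) auto
  have path_meas [measurable]: "sample_path D \<in> M \<rightarrow>\<^sub>M path_space"
    by (intro measurable_sample_path D_meas)
  \<comment> \<open>A functional of the path alone. At the restarted path it is independent of D_a;
    at the path of D itself it integrates to G(UNIV \<times> B).\<close>
  define V where "V d = (\<integral>\<^sup>+\<tau>. weight \<tau> * indicator B (path_increments \<tau> d) \<partial>times)" for d
  have V_meas [measurable]: "V \<in> borel_measurable path_space"
    unfolding V_def by measurable
  have nn: "emeasure G (A \<times> B) = (\<integral>\<^sup>+\<omega>. \<integral>\<^sup>+t. weight t * (indicator A (E (t 1) \<omega>) * indicator B (increments t \<omega>)) \<partial>times \<partial>M)"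
    if [measurable]: "A \<in> sets borel" for A
  proof -
    have "emeasure G (A \<times> B) = (\<integral>\<^sup>+q. indicator A (fst q) * indicator B (snd q) \<partial>G)"
    proof -
      have "A \<times> B \<in> sets G" by (simp add: sets_G)
      then have "emeasure G (A \<times> B) = (\<integral>\<^sup>+q. indicator (A \<times> B) q \<partial>G)" by simp
      also have "\<dots> = (\<integral>\<^sup>+q. indicator A (fst q) * indicator B (snd q) \<partial>G)"
        by (simp add: indicator_times)
      finally show ?thesis .
    qed
    then show ?thesis by (subst (asm) nn_integral_G) auto
  qed
  have "emeasure G ({a<..} \<times> B) = (\<integral>\<^sup>+\<omega>. ennreal (exp (- S * D a \<omega>)) * V (sample_path (D_shift a) \<omega>) \<partial>M)"
  proof (subst nn, simp, rule nn_integral_cong_AE)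
    show "AE \<omega> in M. (\<integral>\<^sup>+t. weight t * (indicator {a<..} (E (t 1) \<omega>) * indicator B (increments t \<omega>)) \<partial>times)
        = ennreal (exp (- S * D a \<omega>)) * V (sample_path (D_shift a) \<omega>)"
      using AE_good AE_space
    proof eventually_elim
      case (elim \<omega>)
      let ?F = "\<lambda>t. weight t * (indicator {a<..} (E (t 1) \<omega>) * indicator B (increments t \<omega>))"
      have 1: "(\<lambda>t. (\<omega>, t)) \<in> times \<rightarrow>\<^sub>M M \<Otimes>\<^sub>M times" using elim by simp
      have [measurable]: "(\<lambda>t. E (t 1) \<omega>) \<in> borel_measurable times" "(\<lambda>t. increments t \<omega>) \<in> times \<rightarrow>\<^sub>M vecs"
        using measurable_compose[OF 1 measurable_E[of 1]] measurable_compose[OF 1 measurable_increments] by simp_all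
      have F_meas: "?F \<in> borel_measurable times" by measurable
      \<comment> \<open>Here \<omega> is fixed, so D_a is a constant, and Lebesgue measure on the
        times is invariant under adding it to every coordinate.\<close>
      have tr_meas: "(\<lambda>t. \<lambda>i\<in>idx. t i + D a \<omega>) \<in> times \<rightarrow>\<^sub>M times"
        by (intro measurable_restrict borel_measurable_add) (auto intro!: measurable_component_singleton)
      have "(\<integral>\<^sup>+t. ?F t \<partial>times) = (\<integral>\<^sup>+t. ?F t \<partial>distr times times (\<lambda>t. \<lambda>i\<in>idx. t i + D a \<omega>))"
        by (simp add: distr_PiM_lborel_translate)
      also have "\<dots> = (\<integral>\<^sup>+\<tau>. ?F (\<lambda>i\<in>idx. \<tau> i + D a \<omega>) \<partial>times)"
        by (rule nn_integral_distr[OF tr_meas]) (use F_meas in simp)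
      also have "\<dots> = (\<integral>\<^sup>+\<tau>. ennreal (exp (- S * D a \<omega>))
          * (weight \<tau> * indicator B (path_increments \<tau> (sample_path (D_shift a) \<omega>))) \<partial>times)"
        using elim a by (intro nn_integral_cong translate_integrand) auto
      also have "\<dots> = ennreal (exp (- S * D a \<omega>)) * V (sample_path (D_shift a) \<omega>)"
      proof -
        have "sample_path (D_shift a) \<omega> \<in> space path_space" by (simp add: space_PiM)
        then have 2: "(\<lambda>t. (sample_path (D_shift a) \<omega>, t)) \<in> times \<rightarrow>\<^sub>M path_space \<Otimes>\<^sub>M times" by simp
        have [measurable]: "(\<lambda>\<tau>. path_increments \<tau> (sample_path (D_shift a) \<omega>)) \<in> times \<rightarrow>\<^sub>M vecs"
          using measurable_compose[OF 2 measurable_path_increments] by simp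
        show ?thesis unfolding V_def by (rule nn_integral_cmult) measurable
      qed
      finally show ?case .
    qed
  qed
  also have "\<dots> = (\<integral>\<^sup>+q. ennreal (exp (- S * fst q)) * V (snd q)
      \<partial>distr M (borel \<Otimes>\<^sub>M path_space) (\<lambda>\<omega>. (D a \<omega>, sample_path (D_shift a) \<omega>)))"
    by (subst nn_integral_distr) auto
  \<comment> \<open>The restarted path is independent of D_a and distributed like the path of D, so
    the integral splits into the Laplace transform of D_a and the mean of V.\<close>
  also have "\<dots> = (\<integral>\<^sup>+q. ennreal (exp (- S * fst q)) * V (snd q)
      \<partial>(distr M borel (D a) \<Otimes>\<^sub>M distr M path_space (sample_path D)))"
    by (simp add: levy_process_shift[OF levy a])
  also have "\<dots> = (\<integral>\<^sup>+x. \<integral>\<^sup>+d. ennreal (exp (- S * x)) * V d \<partial>distr M path_space (sample_path D) \<partial>distr M borel (D a))"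
  proof -
    interpret pD: prob_space "distr M path_space (sample_path D)" by (rule prob_space_distr) simp
    show ?thesis by (subst pD.nn_integral_fst[symmetric]) auto
  qed
  also have "\<dots> = (\<integral>\<^sup>+x. ennreal (exp (- S * x)) * (\<integral>\<^sup>+d. V d \<partial>distr M path_space (sample_path D)) \<partial>distr M borel (D a))"
    by (simp add: nn_integral_cmult)
  also have "\<dots> = (\<integral>\<^sup>+\<omega>. ennreal (exp (- S * D a \<omega>)) \<partial>M) * (\<integral>\<^sup>+\<omega>. V (sample_path D \<omega>) \<partial>M)"
    by (simp add: nn_integral_multc nn_integral_distr)
  also have "(\<integral>\<^sup>+\<omega>. V (sample_path D \<omega>) \<partial>M) = emeasure G (UNIV \<times> B)"
    unfolding nn[OF space_in_borel] V_def
    by (intro nn_integral_cong) (simp add: increments_eq_path_increments)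
  finally show ?thesis by (simp add: nn_laplace[OF a, simplified])
qed

end

section \<open>The boundary measure\<close>

text \<open>Two densities of the same measure agree almost everywhere. By continuity the set where
  they differ is open, and an open null set is empty.\<close>

lemma hhat_density_unique:
  assumes g: "hhat_density n h s l g" and g': "hhat_density n h s l g'" and u: "0 < u"
  shows "g u = g' u"
proof (rule ccontr)
  assume "g u \<noteq> g' u"
  have cont: "continuous_on {0<..} g" "continuous_on {0<..} g'" and nonneg: "\<And>u. 0 < u \<Longrightarrow> 0 \<le> g u \<and> 0 \<le> g' u"
    using g g' by (auto simp: hhat_density_def)
  have meas: "(\<lambda>u. ennreal (f u) * indicator {0<..} u) \<in> borel_measurable borel"
    if "continuous_on {0<..} f" for f :: "real \<Rightarrow> real"
  proof -
    have "(\<lambda>u. indicator {0<..} u *\<^sub>R f u) \<in> borel_measurable borel"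
      using that by (intro borel_measurable_continuous_on_indicator) auto
    then have "(\<lambda>u. ennreal (indicator {0<..} u *\<^sub>R f u)) \<in> borel_measurable borel" by measurable
    moreover have "ennreal (indicator {0<..} u *\<^sub>R f u) = ennreal (f u) * indicator {0<..} u" for u
      by (simp add: indicator_def)
    ultimately show ?thesis by simp
  qed
  note [measurable] = meas[OF cont(1)] meas[OF cont(2)]
  have "density lborel (\<lambda>u. ennreal (g u) * indicator {0<..} u) = density lborel (\<lambda>u. ennreal (g' u) * indicator {0<..} u)"
  proof (rule measure_eqI)
    fix B assume "B \<in> sets (density lborel (\<lambda>u. ennreal (g u) * indicator {0<..} u))"
    then have [measurable]: "B \<in> sets borel" by simp
    have "hhat_first n h s l B = (\<integral>\<^sup>+u. ennreal (f u) * indicator {0<..} u * indicator B u \<partial>lborel)"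
      if "hhat_density n h s l f" for f
    proof -
      have "hhat_first n h s l B = (\<integral>\<^sup>+u. ennreal (f u) * indicator (B \<inter> {0<..}) u \<partial>lborel)"
        using that \<open>B \<in> sets borel\<close> by (auto simp: hhat_density_def)
      then show ?thesis by (simp add: indicator_inter_arith mult_ac)
    qed
    from this[OF g] this[OF g']
    show "emeasure (density lborel (\<lambda>u. ennreal (g u) * indicator {0<..} u)) B
        = emeasure (density lborel (\<lambda>u. ennreal (g' u) * indicator {0<..} u)) B"
      by (simp add: emeasure_density)
  qed simp
  then have "AE u in lborel. ennreal (g u) * indicator {0<..} u = ennreal (g' u) * indicator {0<..} u"
    by (subst (asm) sigma_finite_measure.density_unique_iff[OF lborel.sigma_finite_measure_axioms]) auto
  then have AE_eq: "AE u in lborel. 0 < u \<longrightarrow> g u = g' u"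
    by eventually_elim (auto simp: nonneg)
  define U where "U = {u \<in> {0<..}. g u - g' u \<in> - {0}}"
  have U: "open U"
    unfolding U_def using cont
    by (intro continuous_open_preimage[unfolded vimage_def Int_def mem_Collect_eq] continuous_on_diff) auto
  have "U \<noteq> {}" using u \<open>g u \<noteq> g' u\<close> by (auto simp: U_def)
  have "U \<in> null_sets lborel"
    using AE_eq U by (intro AE_iff_null_sets[THEN iffD2]) (auto simp: U_def elim!: eventually_mono)
  then have "negligible U" by (auto simp: negligible_iff_null_sets intro: null_sets_completionI)
  then show False using open_not_negligible U \<open>U \<noteq> {}\<close> by blast
qed

section \<open>Product form of the weighted law\<close>

context inverse_subordinator
begin

lemma sets_h0 [measurable_cong]: "sets h0 = sets vecs"
  by (simp add: h0_def)

lemma snd_G [measurable]: "snd \<in> G \<rightarrow>\<^sub>M vecs"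
  by (subst measurable_cong_sets[OF sets_G refl]) simp

lemma nn_integral_h0:
  assumes [measurable]: "f \<in> borel_measurable vecs"
  shows "(\<integral>\<^sup>+w. f w \<partial>h0) = ennreal (- \<phi>) * (\<integral>\<^sup>+q. f (snd q) \<partial>G)"
  unfolding h0_def by (simp add: nn_integral_density nn_integral_distr nn_integral_cmult)

lemma emeasure_h0:
  assumes [measurable]: "B \<in> sets vecs"
  shows "emeasure h0 B = ennreal (- \<phi>) * emeasure G (UNIV \<times> B)"
proof -
  have "emeasure h0 B = (\<integral>\<^sup>+w. indicator B w \<partial>h0)" by (simp add: sets_h0)
  also have "\<dots> = ennreal (- \<phi>) * (\<integral>\<^sup>+q. indicator B (snd q) \<partial>G)" by (rule nn_integral_h0) simp
  also have "(\<integral>\<^sup>+q. indicator B (snd q) \<partial>G) = (\<integral>\<^sup>+q. indicator (UNIV \<times> B) q \<partial>G)"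
    by (intro nn_integral_cong) (auto simp: indicator_def)
  also have "\<dots> = emeasure G (UNIV \<times> B)" by (simp add: sets_G)
  finally show ?thesis .
qed

lemma finite_measure_h0: "finite_measure h0"
proof (rule finite_measureI)
  interpret G: finite_measure G by (rule finite_measure_G)
  have "space h0 \<in> sets vecs" using sets.top[of h0] by (simp add: sets_h0)
  then show "emeasure h0 (space h0) \<noteq> \<infinity>"
    by (simp add: emeasure_h0 ennreal_mult_eq_top_iff)
qed

lemma emeasure_exp_measure_greaterThan:
  "emeasure exp_measure {x<..} = ennreal (exp (max x 0 * \<phi>) / - \<phi>)"
proof -
  have "emeasure exp_measure {x<..} = (\<integral>\<^sup>+u. ennreal (exp (\<phi> * u)) * indicator {max x 0<..} u \<partial>lborel)"
    unfolding exp_measure_def by (subst emeasure_density) (auto intro!: nn_integral_cong simp: indicator_def)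
  then show ?thesis using nn_integral_exp_greaterThan[OF \<phi>_neg, of "max x 0"] by (simp add: mult.commute)
qed

lemma finite_measure_exp_measure: "finite_measure exp_measure"
proof (rule finite_measureI)
  have "emeasure exp_measure (space exp_measure) = emeasure exp_measure {0<..}"
    unfolding exp_measure_def by (simp add: emeasure_density mult.assoc flip: indicator_inter_arith)
  then show "emeasure exp_measure (space exp_measure) \<noteq> \<infinity>" by (simp add: emeasure_exp_measure_greaterThan)
qed

text \<open>For fixed B the renewal identity gives the values of C \<mapsto> G(C \<times> B) on all
  half-lines (x,\<infinity>), and these determine a finite measure on the line: a multiple of the
  exponential one.\<close>

theorem G_eq: "exp_measure \<Otimes>\<^sub>M h0 = G"
proof (rule pair_measure_eqI)
  interpret G: finite_measure G by (rule finite_measure_G)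
  show "sigma_finite_measure exp_measure" "sigma_finite_measure h0"
    using finite_measure_exp_measure finite_measure_h0 by (auto intro: finite_measure.sigma_finite_measure)
  have "sets exp_measure = sets borel" by (simp add: exp_measure_def)
  then show "sets (exp_measure \<Otimes>\<^sub>M h0) = sets G"
    by (simp add: sets_G sets_h0 cong: sets_pair_measure_cong)
  fix A B assume "A \<in> sets exp_measure" "B \<in> sets h0"
  then have A [measurable]: "A \<in> sets borel" and B [measurable]: "B \<in> sets vecs"
    by (simp_all add: sets_h0 exp_measure_def)
  define \<nu>1 where "\<nu>1 = distr (density G (\<lambda>q. indicator B (snd q))) borel fst"
  define \<nu>2 where "\<nu>2 = scale_measure (emeasure h0 B) exp_measure"
  have \<nu>1: "emeasure \<nu>1 C = emeasure G (C \<times> B)" if [measurable]: "C \<in> sets borel" for C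
  proof -
    have [measurable]: "fst \<in> G \<rightarrow>\<^sub>M borel"
      by (subst measurable_cong_sets[OF sets_G refl]) simp
    have "emeasure \<nu>1 C = (\<integral>\<^sup>+x. indicator C x \<partial>\<nu>1)" by (simp add: \<nu>1_def)
    also have "\<dots> = (\<integral>\<^sup>+q. indicator B (snd q) * indicator C (fst q) \<partial>G)"
      unfolding \<nu>1_def by (subst nn_integral_distr, simp, simp, subst nn_integral_density) (simp_all, measurable)
    also have "\<dots> = (\<integral>\<^sup>+q. indicator (C \<times> B) q \<partial>G)"
      by (intro nn_integral_cong) (auto simp: indicator_def)
    also have "\<dots> = emeasure G (C \<times> B)" by (simp add: sets_G)
    finally show ?thesis .
  qed
  have "\<nu>1 = \<nu>2"
  proof (rule measure_eqI_lessThan)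
    fix x :: real
    show "emeasure \<nu>1 {x<..} < \<infinity>" by (simp add: \<nu>1 less_top[symmetric])
    have "emeasure \<nu>1 {x<..} = emeasure G ({max x 0<..} \<times> B)"
    proof (cases "0 \<le> x")
      \<comment> \<open>Renewal at a = 0 shows that G has no mass at nonpositive first coordinates,
        so a half-line starting below 0 may start at 0.\<close>
      case False
      have "emeasure G ({0<..} \<times> B) = emeasure G (UNIV \<times> B)" using renewal[OF B, of 0] by simp
      moreover have "emeasure G ({0<..} \<times> B) \<le> emeasure G ({x<..} \<times> B)" "emeasure G ({x<..} \<times> B) \<le> emeasure G (UNIV \<times> B)"
        using False by (auto intro!: emeasure_mono simp: sets_G)
      ultimately show ?thesis using False by (simp add: \<nu>1 max_def)
    qed (simp add: \<nu>1 max_def)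
    also have "\<dots> = ennreal (exp (max x 0 * \<phi>)) * emeasure G (UNIV \<times> B)"
      by (rule renewal[OF B]) simp
    also have "\<dots> = emeasure \<nu>2 {x<..}"
    proof -
      have "ennreal (exp (max x 0 * \<phi>)) = ennreal (- \<phi>) * ennreal (exp (max x 0 * \<phi>) / - \<phi>)"
        using \<phi>_neg by (subst ennreal_mult[symmetric]) (auto simp: divide_nonneg_neg divide_nonpos_neg)
      then show ?thesis
        by (simp add: \<nu>2_def emeasure_exp_measure_greaterThan emeasure_h0 mult_ac)
    qed
    finally show "emeasure \<nu>1 {x<..} = emeasure \<nu>2 {x<..}" .
  qed (simp_all add: \<nu>1_def \<nu>2_def exp_measure_def)
  then have "emeasure \<nu>1 A = emeasure \<nu>2 A" by simp
  then show "emeasure exp_measure A * emeasure h0 B = emeasure G (A \<times> B)"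
    by (simp add: \<nu>1 \<nu>2_def mult.commute)
qed

section \<open>Support of the boundary measure\<close>

lemma measurable_ordered_region: "ordered_region n \<inter> space vecs \<in> sets vecs"
proof -
  have [measurable]: "(\<lambda>w. w i) \<in> borel_measurable vecs" if "i \<in> idx2" for i
    using measurable_component_singleton[OF that, of "\<lambda>_. borel"] by simp
  have eq: "ordered_region n \<inter> space vecs = {w \<in> space vecs. (\<forall>i\<in>idx2. 0 \<le> w i) \<and> (\<forall>i\<in>{2..<n}. w i \<le> w (Suc i))}"
    by (auto simp: ordered_region_def space_PiM PiE_iff idx2_def extensional_def)
  show ?thesis unfolding eq
  proof (intro sets.sets_Collect_conj sets.sets_Collect_countable_All' countable_finite)
    fix i assume "i \<in> {2..<n}"
    then have [measurable]: "(\<lambda>w. w i) \<in> borel_measurable vecs" "(\<lambda>w. w (Suc i)) \<in> borel_measurable vecs"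
      by (auto intro!: measurable_component_singleton simp: idx2_def)
    show "{w \<in> space vecs. w i \<le> w (Suc i)} \<in> sets vecs" by measurable
  qed (simp_all, measurable)
qed

lemma increments_in_region:
  assumes "\<forall>r. \<exists>u>0. r < D u \<omega>" "ordered_times n t"
  shows "increments t \<omega> \<in> ordered_region n"
proof -
  have mono: "E (t i) \<omega> \<le> E (t j) \<omega>" if "1 \<le> i" "i \<le> j" "j \<le> n" for i j
    using assms that by (intro mono_inverse_process ordered_times_mono[of n]) auto
  show ?thesis
    unfolding ordered_region_def increments_def idx2_def using mono by auto
qed

text \<open>The inverse of D is monotone in time and \<open>weight\<close> charges ordered times
  only. The nonnegativity obtained here feeds the uniqueness of Laplace transforms, and the ordering
  makes integration over \<open>ordered_region\<close> the same as over the whole space.\<close>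

lemma AE_h0_region: "AE w in h0. w \<in> ordered_region n"
proof -
  define C where "C = space vecs - ordered_region n"
  have C [measurable]: "C \<in> sets vecs"
    using sets.Diff[OF sets.top measurable_ordered_region] by (simp add: C_def Diff_Int)
  have "(\<integral>\<^sup>+q. indicator C (snd q) \<partial>G) = (\<integral>\<^sup>+\<omega>. \<integral>\<^sup>+t. weight t * indicator C (increments t \<omega>) \<partial>times \<partial>M)"
    by (subst nn_integral_G) auto
  also have "\<dots> = (\<integral>\<^sup>+\<omega>. 0 \<partial>M)"
  proof (rule nn_integral_cong_AE)
    show "AE \<omega> in M. (\<integral>\<^sup>+t. weight t * indicator C (increments t \<omega>) \<partial>times) = 0"
      using AE_unbounded
    proof eventually_elim
      case (elim \<omega>)
      have "weight t * indicator C (increments t \<omega>) = 0" for t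
        using increments_in_region[OF elim, of t] by (auto simp: weight_def C_def)
      then show ?case by (simp only: nn_integral_const mult_zero_left)
    qed
  qed
  finally have "(\<integral>\<^sup>+w. indicator C w \<partial>h0) = 0" by (subst nn_integral_h0) simp_all
  moreover have "(\<integral>\<^sup>+w. indicator C w \<partial>h0) = emeasure h0 C"
    by (rule nn_integral_indicator) (simp add: sets_h0)
  ultimately have "C \<in> null_sets h0" by (simp add: null_sets_def sets_h0)
  then show ?thesis
    by (rule AE_I') (auto simp: C_def sets_eq_imp_space_eq[OF sets_h0])
qed

section \<open>The density of the first variable and its limit at zero\<close>

lemma nn_integral_ordered_law_E:
  assumes [measurable]: "f \<in> borel_measurable (PiM idx (\<lambda>_. borel))"
  shows "(\<integral>\<^sup>+u. f u \<partial>ordered_law M E n t) = (if ordered_times n t then \<integral>\<^sup>+\<omega>. f (\<lambda>i\<in>idx. E (t i) \<omega>) \<partial>M else 0)"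
proof -
  have "(\<lambda>\<omega>. E r \<omega>) \<in> borel_measurable M" for r
    using measurable_compose[OF _ measurable_inverse_process[OF levy], of "\<lambda>\<omega>. (\<omega>, r)" M] by simp
  then have "(\<lambda>\<omega>. \<lambda>i\<in>idx. E (t i) \<omega>) \<in> M \<rightarrow>\<^sub>M PiM idx (\<lambda>_. borel)"
    by (intro measurable_restrict)
  then have "(\<integral>\<^sup>+u. f u \<partial>distr M (PiM idx (\<lambda>_. borel)) (\<lambda>\<omega>. \<lambda>i\<in>idx. E (t i) \<omega>)) = (\<integral>\<^sup>+\<omega>. f (\<lambda>i\<in>idx. E (t i) \<omega>) \<partial>M)"
    by (rule nn_integral_distr) simp
  then show ?thesis
    by (simp only: ordered_law_def joint_law_def idx_def[symmetric] if_distrib[of "\<lambda>N. integral\<^sup>N N f"] nn_integral_null_measure)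
qed

definition laplace_h0 :: "(nat \<Rightarrow> real) \<Rightarrow> ennreal" where
  "laplace_h0 l = (\<integral>\<^sup>+w. ennreal (exp (- (\<Sum>i\<in>idx2. l i * w i))) \<partial>h0)"

lemma laplace_h0_finite:
  assumes "\<And>i. i \<in> idx2 \<Longrightarrow> 0 < l i"
  shows "laplace_h0 l < \<infinity>"
proof -
  interpret h0: finite_measure h0 by (rule finite_measure_h0)
  have "laplace_h0 l \<le> (\<integral>\<^sup>+w. 1 \<partial>h0)"
    unfolding laplace_h0_def
  proof (rule nn_integral_mono_AE)
    show "AE w in h0. ennreal (exp (- (\<Sum>i\<in>idx2. l i * w i))) \<le> 1"
      using AE_h0_region
    proof eventually_elim
      case (elim w)
      then have "0 \<le> l i * w i" if "i \<in> idx2" for i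
        using that assms[OF that] by (auto simp: ordered_region_def idx2_def PiE_iff)
      then have "0 \<le> (\<Sum>i\<in>idx2. l i * w i)" by (rule sum_nonneg)
      then show ?case by simp
    qed
  qed
  also have "\<dots> < \<infinity>" by (simp add: less_top[symmetric])
  finally show ?thesis .
qed

text \<open>With positions written as u_i = u + w_i, the sum of the l_i u_i equals u times the sum
  of the l_i plus the sum of the l_i w_i. The first part joins \<phi> in the exponential rate, and
  the second leaves the Laplace transform of \<open>h0\<close> because G is a product.\<close>

lemma hhat_first_eq:
  assumes B [measurable]: "B \<in> sets borel"
  shows "hhat_first n (ordered_law M E n) s l B
    = (\<integral>\<^sup>+u. ennreal (exp ((\<phi> - (\<Sum>i\<in>idx2. l i)) * u)) * laplace_h0 l * indicator (B \<inter> {0<..}) u \<partial>lborel)"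
proof -
  interpret times: sigma_finite_measure times by (rule sigma_finite_times)
  interpret pair_sigma_finite M times ..
  interpret h0: finite_measure h0 by (rule finite_measure_h0)
  define F where "F t e = ennreal (exp (- (\<Sum>i\<in>idx. s i * t i) - (\<Sum>i\<in>idx2. l i * e i))) * indicator B (e 1)"
    for t e :: "nat \<Rightarrow> real"
  \<comment> \<open>The integrand in the coordinates of G: adding the first coordinate to the
    increments restores the positions.\<close>
  define H where "H q = ennreal (exp (- (\<Sum>i\<in>idx2. l i * (snd q i + fst q)))) * indicator B (fst q)"
    for q :: "real \<times> (nat \<Rightarrow> real)"
  have comp: "(\<lambda>w. w i) \<in> borel_measurable vecs" if "i \<in> idx2" for i
    using measurable_component_singleton[OF that, of "\<lambda>_. borel"] by simp
  have H_meas [measurable]: "H \<in> borel_measurable (borel \<Otimes>\<^sub>M vecs)"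
  proof -
    note [measurable] = comp
    show ?thesis unfolding H_def by measurable
  qed
  have [measurable]: "(\<lambda>p. E (snd p 1) (fst p)) \<in> borel_measurable (M \<Otimes>\<^sub>M times)"
    using measurable_E[of 1] by simp
  have "hhat_first n (ordered_law M E n) s l B = (\<integral>\<^sup>+t. \<integral>\<^sup>+e. F t e \<partial>ordered_law M E n t \<partial>times)"
    by (simp add: hhat_first_def F_def idx_def idx2_def)
  also have "\<dots> = (\<integral>\<^sup>+t. \<integral>\<^sup>+\<omega>. weight t * H (E (t 1) \<omega>, increments t \<omega>) \<partial>M \<partial>times)"
  proof (rule nn_integral_cong)
    fix t
    have [measurable]: "(\<lambda>e. e i) \<in> borel_measurable (PiM idx (\<lambda>_. borel))" if "i \<in> idx" for i
      using measurable_component_singleton[OF that, of "\<lambda>_. borel"] by simp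
    have [measurable]: "(\<lambda>e. e (Suc 0)) \<in> borel_measurable (PiM idx (\<lambda>_. borel :: real measure))"
      by measurable
    have F_meas: "F t \<in> borel_measurable (PiM idx (\<lambda>_. borel))"
      unfolding F_def by measurable
    have "F t (\<lambda>i\<in>idx. E (t i) \<omega>) = weight t * H (E (t 1) \<omega>, increments t \<omega>)" if "ordered_times n t" for \<omega>
    proof -
      have "(\<Sum>i\<in>idx2. l i * (\<lambda>i\<in>idx. E (t i) \<omega>) i) = (\<Sum>i\<in>idx2. l i * (increments t \<omega> i + E (t 1) \<omega>))"
        by (intro sum.cong) (auto simp: increments_def)
      then show ?thesis
        using that by (simp add: F_def H_def weight_def exp_diff exp_minus divide_inverse ennreal_mult mult.assoc)
    qed
    then show "(\<integral>\<^sup>+e. F t e \<partial>ordered_law M E n t) = (\<integral>\<^sup>+\<omega>. weight t * H (E (t 1) \<omega>, increments t \<omega>) \<partial>M)"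
      by (subst nn_integral_ordered_law_E[OF F_meas]) (simp add: weight_def)
  qed
  also have "\<dots> = (\<integral>\<^sup>+\<omega>. \<integral>\<^sup>+t. weight t * H (E (t 1) \<omega>, increments t \<omega>) \<partial>times \<partial>M)"
    by (rule Fubini') (simp add: split_beta)
  also have "\<dots> = (\<integral>\<^sup>+q. H q \<partial>G)" by (rule nn_integral_G[symmetric]) measurable
  also have "\<dots> = (\<integral>\<^sup>+u. \<integral>\<^sup>+w. H (u, w) \<partial>h0 \<partial>exp_measure)"
    unfolding G_eq[symmetric]
    by (rule h0.nn_integral_fst[symmetric]) (simp add: exp_measure_def)
  also have "\<dots> = (\<integral>\<^sup>+u. ennreal (exp (- (\<Sum>i\<in>idx2. l i) * u)) * indicator B u * laplace_h0 l \<partial>exp_measure)"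
  proof (rule nn_integral_cong)
    fix u
    have "(\<integral>\<^sup>+w. H (u, w) \<partial>h0) = (\<integral>\<^sup>+w. (ennreal (exp (- (\<Sum>i\<in>idx2. l i) * u)) * indicator B u)
        * ennreal (exp (- (\<Sum>i\<in>idx2. l i * w i))) \<partial>h0)"
    proof (rule nn_integral_cong)
      fix w
      have "- (\<Sum>i\<in>idx2. l i * (w i + u)) = - (\<Sum>i\<in>idx2. l i) * u + - (\<Sum>i\<in>idx2. l i * w i)"
        by (simp add: distrib_left sum.distrib sum_distrib_right)
      then show "H (u, w) = (ennreal (exp (- (\<Sum>i\<in>idx2. l i) * u)) * indicator B u)
          * ennreal (exp (- (\<Sum>i\<in>idx2. l i * w i)))"
        by (simp only: H_def fst_conv snd_conv exp_add ennreal_mult exp_ge_zero) (simp add: mult_ac)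
    qed
    also have "\<dots> = ennreal (exp (- (\<Sum>i\<in>idx2. l i) * u)) * indicator B u * laplace_h0 l"
    proof -
      note [measurable] = comp
      show ?thesis unfolding laplace_h0_def by (rule nn_integral_cmult) measurable
    qed
    finally show "(\<integral>\<^sup>+w. H (u, w) \<partial>h0) = ennreal (exp (- (\<Sum>i\<in>idx2. l i) * u)) * indicator B u * laplace_h0 l" .
  qed
  also have "\<dots> = (\<integral>\<^sup>+u. ennreal (exp ((\<phi> - (\<Sum>i\<in>idx2. l i)) * u)) * laplace_h0 l * indicator (B \<inter> {0<..}) u \<partial>lborel)"
    unfolding exp_measure_def
  proof (subst nn_integral_density)
    have "exp ((\<phi> - (\<Sum>i\<in>idx2. l i)) * u) = exp (\<phi> * u) * exp (- (\<Sum>i\<in>idx2. l i) * u)" for u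
      by (simp add: exp_add[symmetric] algebra_simps)
    then show "(\<integral>\<^sup>+u. ennreal (exp (\<phi> * u)) * indicator {0<..} u * (ennreal (exp (- (\<Sum>i\<in>idx2. l i) * u)) * indicator B u * laplace_h0 l) \<partial>lborel)
        = (\<integral>\<^sup>+u. ennreal (exp ((\<phi> - (\<Sum>i\<in>idx2. l i)) * u)) * laplace_h0 l * indicator (B \<inter> {0<..}) u \<partial>lborel)"
      by (intro nn_integral_cong) (simp add: ennreal_mult indicator_inter_arith mult_ac)
  qed measurable
  finally show ?thesis .
qed

text \<open>The exponential prefactor is 1 at u = 0, so the limit is the Laplace transform of
  \<open>h0\<close>.\<close>

lemma hhat_density_E:
  assumes l: "\<And>i. i \<in> idx2 \<Longrightarrow> 0 < l i"
  defines "g \<equiv> \<lambda>u. exp ((\<phi> - (\<Sum>i\<in>idx2. l i)) * u) * enn2real (laplace_h0 l)"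
  shows "hhat_density n (ordered_law M E n) s l g" "(g \<longlongrightarrow> enn2real (laplace_h0 l)) (at_right 0)"
proof -
  have "ennreal (g u) = ennreal (exp ((\<phi> - (\<Sum>i\<in>idx2. l i)) * u)) * laplace_h0 l" for u
    unfolding g_def using laplace_h0_finite[OF l] by (simp add: ennreal_mult)
  then show "hhat_density n (ordered_law M E n) s l g"
    unfolding hhat_density_def
    by (intro conjI) (auto simp: hhat_first_eq g_def intro!: continuous_intros)
  have "isCont g 0" unfolding g_def by (intro continuous_intros)
  then show "(g \<longlongrightarrow> enn2real (laplace_h0 l)) (at_right 0)"
    unfolding isCont_def filterlim_at_split by (simp add: g_def)
qed

text \<open>Any other candidate comes with a continuous density, which must be the explicit one;
  hence it has the same limits and the same Laplace transform as \<open>h0\<close>. The equivalence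
  settles both existence and uniqueness, and thereby evaluates the definite description.\<close>

theorem is_hhat_zero_plus_iff: "is_hhat_zero_plus n (ordered_law M E n) s \<mu> \<longleftrightarrow> \<mu> = h0"
proof
  assume \<mu>: "is_hhat_zero_plus n (ordered_law M E n) s \<mu>"
  have laplace_eq: "(\<integral>\<^sup>+u. ennreal (exp (- (\<Sum>i\<in>idx2. l i * u i))) \<partial>\<mu>) = laplace_h0 l"
    if l: "\<And>i. i \<in> idx2 \<Longrightarrow> 0 < l i" for l
  proof -
    obtain g L where g: "hhat_density n (ordered_law M E n) s l g" "(g \<longlongrightarrow> L) (at_right 0)"
      and L: "(\<integral>\<^sup>+u. ennreal (exp (- (\<Sum>i\<in>idx2. l i * u i))) \<partial>\<mu>) = ennreal L"
      using \<mu> l unfolding is_hhat_zero_plus_def idx2_def by blast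
    have "(g \<longlongrightarrow> enn2real (laplace_h0 l)) (at_right 0)"
    proof (rule Lim_transform_eventually[OF hhat_density_E(2)[of l, OF l]])
      show "\<forall>\<^sub>F u in at_right 0. exp ((\<phi> - sum l idx2) * u) * enn2real (laplace_h0 l) = g u"
        unfolding eventually_at_filter
        by (intro always_eventually allI impI hhat_density_unique[OF hhat_density_E(1)[of l, OF l] g(1)]) auto
    qed
    then have "L = enn2real (laplace_h0 l)"
      using g(2) by (intro tendsto_unique[of "at_right 0" g]) auto
    then show ?thesis using L laplace_h0_finite[of l, OF l] by simp
  qed
  show "\<mu> = h0"
  proof (rule measure_PiM_eqI_laplace[of idx2])
    show "AE u in h0. \<forall>i\<in>idx2. 0 \<le> u i"
      using AE_h0_region by eventually_elim (auto simp: ordered_region_def idx2_def PiE_iff)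
  qed (use \<mu> laplace_eq laplace_h0_finite in \<open>auto simp: is_hhat_zero_plus_def idx2_def[symmetric] sets_h0 laplace_h0_def[symmetric]\<close>)
next
  assume "\<mu> = h0"
  moreover have "AE u in h0. \<forall>i\<in>idx2. 0 \<le> u i"
    using AE_h0_region by eventually_elim (auto simp: ordered_region_def idx2_def PiE_iff)
  moreover have "\<exists>g L. hhat_density n (ordered_law M E n) s l g \<and> (g \<longlongrightarrow> L) (at_right 0) \<and>
      (\<integral>\<^sup>+u. ennreal (exp (- (\<Sum>i\<in>idx2. l i * u i))) \<partial>h0) = ennreal L"
    if "\<forall>i\<in>idx2. 0 < l i" for l
    using hhat_density_E[of l] laplace_h0_finite[of l] that
    by (intro exI[of _ "\<lambda>u. exp ((\<phi> - (\<Sum>i\<in>idx2. l i)) * u) * enn2real (laplace_h0 l)"]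
        exI[of _ "enn2real (laplace_h0 l)"]) (simp add: laplace_h0_def)
  ultimately show "is_hhat_zero_plus n (ordered_law M E n) s \<mu>"
    unfolding is_hhat_zero_plus_def idx2_def[symmetric] using sets_h0 by blast
qed

end

section \<open>The time-changed process\<close>

text \<open>The norm of exp(u c) is exp(u Re c), so integrability and the vanishing of the
  antiderivative at infinity reduce to the real case.\<close>

lemma integral_exp_greaterThan:
  fixes c :: complex
  assumes "Re c < 0"
  shows "(LINT u|lborel. indicator {0<..} u *\<^sub>R exp (complex_of_real u * c)) = - 1 / c"
proof -
  have [simp]: "c \<noteq> 0" using assms by auto
  have integrable: "integrable lborel (\<lambda>u. indicator {0<..} u *\<^sub>R exp (complex_of_real u * c))"
  proof (rule integrableI_bounded)
    have "(\<integral>\<^sup>+u. ennreal (norm (indicator {0<..} u *\<^sub>R exp (complex_of_real u * c))) \<partial>lborel)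
        = (\<integral>\<^sup>+u. ennreal (exp (Re c * u)) * indicator {0<..} u \<partial>lborel)"
      by (intro nn_integral_cong) (auto simp: indicator_def norm_exp_eq_Re mult.commute)
    also have "\<dots> < \<infinity>" using nn_integral_exp_greaterThan[OF assms, of 0] by simp
    finally show "(\<integral>\<^sup>+u. ennreal (norm (indicator {0<..} u *\<^sub>R exp (complex_of_real u * c))) \<partial>lborel) < \<infinity>" .
  qed measurable
  have "(LBINT u=0..\<infinity>. exp (complex_of_real u * c)) = 0 - exp (complex_of_real 0 * c) / c"
  proof (rule interval_integral_FTC_integrable)
    show "((\<lambda>u. exp (complex_of_real u * c) / c) has_vector_derivative exp (complex_of_real u * c)) (at u)" for u
    proof -
      have "((\<lambda>z. exp (z * c) / c) has_field_derivative exp (complex_of_real u * c)) (at (complex_of_real u))"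
        by (auto intro!: derivative_eq_intros)
      from has_vector_derivative_real_field[OF this] show ?thesis by simp
    qed
    show "isCont (\<lambda>u. exp (complex_of_real u * c)) u" for u by (intro continuous_intros)
    show "set_integrable lborel (einterval 0 \<infinity>) (\<lambda>u. exp (complex_of_real u * c))"
      using integrable by (simp add: set_integrable_def zero_ereal_def)
    have "isCont (\<lambda>u. exp (complex_of_real u * c) / c) 0" by (intro continuous_intros) simp
    then have "((\<lambda>u. exp (complex_of_real u * c) / c) \<longlongrightarrow> exp (complex_of_real 0 * c) / c) (at_right 0)"
      unfolding isCont_def filterlim_at_split by simp
    then show "(((\<lambda>u. exp (complex_of_real u * c) / c) \<circ> real_of_ereal) \<longlongrightarrow> exp (complex_of_real 0 * c) / c) (at_right 0)"
      by (simp add: zero_ereal_def ereal_tendsto_simps)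
    have "filterlim (\<lambda>u. Re c * u) at_bot at_top"
      using assms by (intro filterlim_tendsto_neg_mult_at_bot[OF tendsto_const]) (auto simp: filterlim_ident)
    then have "((\<lambda>u. exp (Re c * u)) \<longlongrightarrow> 0) at_top" by (rule filterlim_compose[OF exp_at_bot])
    then have "((\<lambda>u. norm (exp (complex_of_real u * c))) \<longlongrightarrow> 0) at_top"
      by (simp add: norm_exp_eq_Re mult.commute)
    then have "((\<lambda>u. exp (complex_of_real u * c)) \<longlongrightarrow> 0) at_top" by (rule tendsto_norm_zero_cancel)
    then have "((\<lambda>u. exp (complex_of_real u * c) / c) \<longlongrightarrow> 0) at_top"
      using tendsto_divide[of _ 0 at_top "\<lambda>_. c" c] by simp
    then show "(((\<lambda>u. exp (complex_of_real u * c) / c) \<circ> real_of_ereal) \<longlongrightarrow> 0) (at_left \<infinity>)"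
      by (simp add: ereal_tendsto_simps)
  qed simp
  moreover have "(LBINT u=0..\<infinity>. exp (complex_of_real u * c)) = (LINT u|lborel. indicator {0<..} u *\<^sub>R exp (complex_of_real u * c))"
    by (simp add: interval_lebesgue_integral_def set_lebesgue_integral_def zero_ereal_def)
  ultimately show ?thesis by (simp add: divide_inverse)
qed

lemma fourier_joint_law:
  assumes "\<And>i. i \<in> I \<Longrightarrow> Y (t i) \<in> borel_measurable M"
  shows "fourier I (joint_law M Y I t) k = (LINT \<omega>|M. exp (- \<i> * complex_of_real (\<Sum>j\<in>I. k j * Y (t j) \<omega>)))"
proof -
  have "(\<lambda>x. \<Sum>j\<in>I. k j * x j) \<in> borel_measurable (PiM I (\<lambda>_. borel :: real measure))"
    by (intro borel_measurable_sum borel_measurable_times measurable_component_singleton) auto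
  then have wave: "(\<lambda>x. exp (- \<i> * complex_of_real (\<Sum>j\<in>I. k j * x j))) \<in> borel_measurable (PiM I (\<lambda>_. borel))"
    by measurable
  have vec: "(\<lambda>\<omega>. \<lambda>i\<in>I. Y (t i) \<omega>) \<in> M \<rightarrow>\<^sub>M PiM I (\<lambda>_. borel)" using assms by (intro measurable_restrict)
  have "fourier I (joint_law M Y I t) k
      = (LINT \<omega>|M. exp (- \<i> * complex_of_real (\<Sum>j\<in>I. k j * (\<lambda>i\<in>I. Y (t i) \<omega>) j)))"
    unfolding fourier_def joint_law_def by (rule integral_distr[OF vec wave])
  also have "\<dots> = (LINT \<omega>|M. exp (- \<i> * complex_of_real (\<Sum>j\<in>I. k j * Y (t j) \<omega>)))"
    by (intro Bochner_Integration.integral_cong arg_cong[where f = exp] arg_cong2[where f = "(*)"]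
        arg_cong[where f = complex_of_real] sum.cong refl) simp
  finally show ?thesis .
qed

text \<open>The fixed \<open>k\<close> is the vector of Fourier variables; in \<open>char_A\<close>
  the bound \<open>k\<close> is a scalar that shadows it.\<close>

locale subordinated_process = inverse_subordinator M D n s \<phi>
  for M :: "'a measure" and D n s \<phi> +
  fixes A :: "real \<Rightarrow> 'a \<Rightarrow> real" and \<psi> :: "real \<Rightarrow> complex" and k :: "nat \<Rightarrow> real"
  assumes levy_A: "levy_process M A"
    and char_A: "\<And>u k. 0 \<le> u \<Longrightarrow>
      (LINT \<omega>|M. exp (\<i> * complex_of_real (k * A u \<omega>))) = exp (complex_of_real u * \<psi> k)"
    and indep: "indep_processes M A D"
begin

definition K :: real where "K = (\<Sum>i\<in>idx. k i)"

definition wave :: "nat set \<Rightarrow> (nat \<Rightarrow> real) \<Rightarrow> complex" where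
  "wave I x = exp (- \<i> * complex_of_real (\<Sum>j\<in>I. k j * x j))"

text \<open>A version of the Fourier transform of \<open>z\<close> that is measurable without restriction to nonnegative times.\<close>

definition zt :: "(nat \<Rightarrow> real) \<Rightarrow> complex" where
  "zt w = (LINT \<omega>|M. wave idx2 (\<lambda>j. path_eval (sample_path A \<omega>) (w j)))"

lemma norm_wave [simp]: "norm (wave I x) = 1"
  by (simp add: wave_def norm_exp_eq_Re)

lemma measurable_wave:
  assumes "\<And>j. j \<in> I \<Longrightarrow> f j \<in> borel_measurable N"
  shows "(\<lambda>x. wave I (\<lambda>j. f j x)) \<in> borel_measurable N"
proof -
  have "(\<lambda>x. \<Sum>j\<in>I. k j * f j x) \<in> borel_measurable N"
    using assms by (intro borel_measurable_sum borel_measurable_times) auto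
  then show ?thesis unfolding wave_def by measurable
qed

lemma A_meas: "0 \<le> u \<Longrightarrow> A u \<in> borel_measurable M"
  by (rule levy_processD(2)[OF levy_A])

lemma path_eval_A: "\<omega> \<in> space M \<Longrightarrow> 0 \<le> u \<Longrightarrow> path_eval (sample_path A \<omega>) u = A u \<omega>"
  using levy_processD(6)[OF levy_A] by (intro path_eval_sample_path) auto

lemma path_A_meas [measurable]: "sample_path A \<in> M \<rightarrow>\<^sub>M path_space"
  by (intro measurable_sample_path A_meas)

lemma path_D_meas [measurable]: "sample_path D \<in> M \<rightarrow>\<^sub>M path_space"
  by (intro measurable_sample_path D_meas)

text \<open>exp(\<psi>(q)) is the mean of a variable of modulus 1. Together with \<phi> < 0 this
  keeps \<phi> + \<psi> in the open left half-plane.\<close>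

lemma Re_\<psi>: "Re (\<psi> q) \<le> 0"
proof -
  have [measurable]: "A 1 \<in> borel_measurable M" by (rule A_meas) simp
  have "norm (exp (complex_of_real 1 * \<psi> q)) \<le> 1"
  proof (subst char_A[symmetric])
    show "norm (LINT \<omega>|M. exp (\<i> * complex_of_real (q * A 1 \<omega>))) \<le> 1"
      by (rule order_trans[OF integral_norm_bound]) (simp add: norm_exp_eq_Re prob_space)
  qed simp
  then show ?thesis by (simp add: norm_exp_eq_Re)
qed

lemma measurable_zt [measurable]: "zt \<in> borel_measurable vecs"
proof -
  have "(\<lambda>p. path_eval (sample_path A (snd p)) (fst p j)) \<in> borel_measurable (vecs \<Otimes>\<^sub>M M)" if "j \<in> idx2" for j
  proof -
    have "(\<lambda>p. (sample_path A (snd p), fst p j)) \<in> vecs \<Otimes>\<^sub>M M \<rightarrow>\<^sub>M path_space \<Otimes>\<^sub>M borel"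
      using that
      by (intro measurable_Pair measurable_compose[OF measurable_snd path_A_meas]
          measurable_compose[OF measurable_fst measurable_component_singleton])
    from measurable_compose[OF this measurable_path_eval] show ?thesis by simp
  qed
  then have "(\<lambda>p. wave idx2 (\<lambda>j. path_eval (sample_path A (snd p)) (fst p j))) \<in> borel_measurable (vecs \<Otimes>\<^sub>M M)"
    by (rule measurable_wave)
  then show ?thesis
    unfolding zt_def by (intro borel_measurable_lebesgue_integral) (simp add: split_beta)
qed

lemma norm_zt: "norm (zt w) \<le> 1"
  unfolding zt_def by (rule order_trans[OF integral_norm_bound]) (simp add: prob_space)

lemma zt_eq:
  assumes "\<And>j. j \<in> idx2 \<Longrightarrow> 0 \<le> w j"
  shows "zt w = (LINT \<omega>|M. wave idx2 (\<lambda>j. A (w j) \<omega>))"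
  unfolding zt_def wave_def using assms
  by (intro Bochner_Integration.integral_cong arg_cong[where f = exp] arg_cong2[where f = "(*)"]
      arg_cong[where f = complex_of_real] sum.cong refl) (simp add: path_eval_A)

lemma fourier_z:
  assumes "\<And>j. j \<in> idx2 \<Longrightarrow> 0 \<le> w j"
  shows "fourier idx2 (joint_law M A idx2 w) k = zt w"
  using assms by (simp add: fourier_joint_law A_meas zt_eq wave_def)

lemma idx_eq: "idx = insert 1 idx2" "1 \<notin> idx2"
  using n by (auto simp: idx_def idx2_def)

text \<open>At deterministic times, the sum of the k_j A(e_j) is K A(e_1) plus a combination of
  increments after e_1, and the Markov property at e_1 separates the two.\<close>

lemma wave_A:
  assumes e: "0 \<le> e 1" "\<And>j. j \<in> idx2 \<Longrightarrow> e 1 \<le> e j"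
  shows "(LINT \<omega>|M. wave idx (\<lambda>j. A (e j) \<omega>))
    = exp (complex_of_real (e 1) * \<psi> (- K)) * zt (\<lambda>j\<in>idx2. e j - e 1)"
proof -
  define a where "a = e 1"
  note e = e[folded a_def]
  let ?d = "\<lambda>\<omega>. sample_path (\<lambda>u \<omega>. A (a + u) \<omega> - A a \<omega>) \<omega>"
  note [measurable] = A_meas[OF e(1)]
  have d_meas [measurable]: "?d \<in> M \<rightarrow>\<^sub>M path_space"
    using e by (intro measurable_sample_path borel_measurable_diff A_meas) auto
  \<comment> \<open>The Fourier transform has exp(-ikx), whereas \<psi> is defined through exp(ikx);
    hence the argument -K.\<close>
  define F1 where "F1 x = exp (\<i> * complex_of_real (- K * x))" for x
  define F2 where "F2 d = wave idx2 (\<lambda>j. d (e j - a))" for d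
  have F1 [measurable]: "F1 \<in> borel_measurable borel" unfolding F1_def by measurable
  have F2 [measurable]: "F2 \<in> borel_measurable path_space"
    unfolding F2_def using e by (intro measurable_wave measurable_component_singleton) auto
  have norm_F: "norm (F1 x) = 1" "norm (F2 d) = 1" for x d by (simp_all add: F1_def F2_def norm_exp_eq_Re)
  have split: "wave idx (\<lambda>j. A (e j) \<omega>) = F1 (A a \<omega>) * F2 (?d \<omega>)" for \<omega>
  proof -
    have "(\<Sum>j\<in>idx. k j * A (e j) \<omega>) = K * A a \<omega> + (\<Sum>j\<in>idx2. k j * ?d \<omega> (e j - a))"
    proof -
      have "(\<Sum>j\<in>idx2. k j * ?d \<omega> (e j - a)) = (\<Sum>j\<in>idx2. k j * A (e j) \<omega>) - (\<Sum>j\<in>idx2. k j) * A a \<omega>"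
        using e by (simp add: right_diff_distrib sum_subtractf sum_distrib_right)
      then show ?thesis using idx_eq by (simp add: K_def distrib_right a_def)
    qed
    then show ?thesis
      by (simp only: wave_def F1_def F2_def exp_add[symmetric]) (simp add: algebra_simps)
  qed
  interpret pA: prob_space "distr M path_space (sample_path A)" by (rule prob_space_distr) simp
  interpret Aa: prob_space "distr M borel (A a)" by (rule prob_space_distr) simp
  interpret pair_prob_space "distr M borel (A a)" "distr M path_space (sample_path A)" ..
  have "(LINT \<omega>|M. wave idx (\<lambda>j. A (e j) \<omega>)) = (LINT \<omega>|M. F1 (A a \<omega>) * F2 (?d \<omega>))"
    by (simp only: split)
  also have "\<dots> = (LINT q|distr M (borel \<Otimes>\<^sub>M path_space) (\<lambda>\<omega>. (A a \<omega>, ?d \<omega>)). F1 (fst q) * F2 (snd q))"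
    by (subst integral_distr) auto
  also have "\<dots> = (LINT q|(distr M borel (A a) \<Otimes>\<^sub>M distr M path_space (sample_path A)). F1 (fst q) * F2 (snd q))"
    by (simp only: levy_process_shift[OF levy_A e(1)])
  also have "\<dots> = (LINT x|distr M borel (A a). LINT d|distr M path_space (sample_path A). F1 x * F2 d)"
  proof (subst integral_fst'[symmetric])
    show "integrable (distr M borel (A a) \<Otimes>\<^sub>M distr M path_space (sample_path A)) (\<lambda>q. F1 (fst q) * F2 (snd q))"
      by (rule P.integrable_const_bound[where B = 1]) (simp_all add: norm_mult norm_F)
  qed simp
  also have "\<dots> = (LINT x|distr M borel (A a). F1 x) * (LINT d|distr M path_space (sample_path A). F2 d)"
    by simp
  also have "(LINT x|distr M borel (A a). F1 x) = exp (complex_of_real a * \<psi> (- K))"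
    using char_A[OF e(1), of "- K"] by (subst integral_distr) (auto simp: F1_def)
  also have "(LINT d|distr M path_space (sample_path A). F2 d) = zt (\<lambda>j\<in>idx2. e j - a)"
  proof -
    have "(LINT d|distr M path_space (sample_path A). F2 d) = (LINT \<omega>|M. F2 (sample_path A \<omega>))"
      by (rule integral_distr) auto
    also have "\<dots> = (LINT \<omega>|M. wave idx2 (\<lambda>j. A ((\<lambda>j\<in>idx2. e j - a) j) \<omega>))"
      unfolding F2_def wave_def using e
      by (intro Bochner_Integration.integral_cong arg_cong[where f = exp] arg_cong2[where f = "(*)"]
          arg_cong[where f = complex_of_real] sum.cong refl) simp
    also have "\<dots> = zt (\<lambda>j\<in>idx2. e j - a)"
      using e by (subst zt_eq) auto
    finally show ?thesis .
  qed
  finally show ?thesis unfolding a_def .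
qed

lemma E_meas: "E r \<in> borel_measurable M"
  using measurable_compose[OF _ measurable_inverse_process[OF levy], of "\<lambda>\<omega>. (\<omega>, r)" M] by simp

lemma time_changed_eq:
  "\<omega> \<in> space M \<Longrightarrow> time_changed A D r \<omega> = path_eval (sample_path A \<omega>) (path_inverse (sample_path D \<omega>) r)"
  by (simp add: time_changed_def E_eq_path_inverse[symmetric] path_eval_A inverse_process_nonneg)

lemma time_changed_meas: "time_changed A D r \<in> borel_measurable M"
proof -
  have "(\<lambda>\<omega>. path_eval (sample_path A \<omega>) (E r \<omega>)) \<in> borel_measurable M"
    using measurable_compose[OF _ measurable_path_eval, of "\<lambda>\<omega>. (sample_path A \<omega>, E r \<omega>)" M] E_meas by simp
  then show ?thesis
    by (subst measurable_cong) (simp_all add: time_changed_eq E_eq_path_inverse)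
qed

text \<open>The wave of X is a functional of the pair of paths, whose law is a product. Integrating
  over the path of A with that of D frozen turns the random times into deterministic ones.\<close>

lemma wave_time_changed:
  assumes t: "ordered_times n t"
  shows "(LINT \<omega>|M. wave idx (\<lambda>j. time_changed A D (t j) \<omega>))
    = (LINT \<omega>|M. exp (complex_of_real (E (t 1) \<omega>) * \<psi> (- K)) * zt (increments t \<omega>))"
proof -
  define F where "F q = wave idx (\<lambda>j. path_eval (fst q) (path_inverse (snd q) (t j)))" for q
  have "(\<lambda>q. path_inverse (snd q) (t j)) \<in> borel_measurable (path_space \<Otimes>\<^sub>M path_space)" for j
  proof -
    have "(\<lambda>q. (snd q, t j)) \<in> path_space \<Otimes>\<^sub>M path_space \<rightarrow>\<^sub>M path_space \<Otimes>\<^sub>M borel" by measurable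
    from measurable_compose[OF this measurable_path_inverse] show ?thesis by simp
  qed
  then have "(\<lambda>q. (fst q, path_inverse (snd q) (t j))) \<in> path_space \<Otimes>\<^sub>M path_space \<rightarrow>\<^sub>M path_space \<Otimes>\<^sub>M borel" for j
    by (intro measurable_Pair measurable_fst)
  from measurable_compose[OF this measurable_path_eval]
  have "(\<lambda>q. path_eval (fst q) (path_inverse (snd q) (t j))) \<in> borel_measurable (path_space \<Otimes>\<^sub>M path_space)" for j
    by simp
  then have F [measurable]: "F \<in> borel_measurable (path_space \<Otimes>\<^sub>M path_space)"
    unfolding F_def by (intro measurable_wave)
  have norm_F: "norm (F q) = 1" for q by (simp add: F_def)
  have law: "distr M (path_space \<Otimes>\<^sub>M path_space) (\<lambda>\<omega>. (sample_path A \<omega>, sample_path D \<omega>))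
      = distr M path_space (sample_path A) \<Otimes>\<^sub>M distr M path_space (sample_path D)"
    using indep unfolding indep_processes_def indep_var_distribution_eq by simp
  interpret pA: prob_space "distr M path_space (sample_path A)" by (rule prob_space_distr) simp
  interpret pD: prob_space "distr M path_space (sample_path D)" by (rule prob_space_distr) simp
  interpret pair_prob_space "distr M path_space (sample_path A)" "distr M path_space (sample_path D)" ..
  have "(LINT \<omega>|M. wave idx (\<lambda>j. time_changed A D (t j) \<omega>)) = (LINT \<omega>|M. F (sample_path A \<omega>, sample_path D \<omega>))"
    by (intro Bochner_Integration.integral_cong) (simp_all add: F_def time_changed_eq)
  also have "\<dots> = (LINT q|distr M (path_space \<Otimes>\<^sub>M path_space) (\<lambda>\<omega>. (sample_path A \<omega>, sample_path D \<omega>)). F q)"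
    by (rule integral_distr[symmetric]) measurable
  also have "\<dots> = (LINT q|(distr M path_space (sample_path A) \<Otimes>\<^sub>M distr M path_space (sample_path D)). F q)"
    by (simp only: law)
  also have "\<dots> = (LINT d|distr M path_space (sample_path D). LINT a|distr M path_space (sample_path A). F (a, d))"
  proof (subst integral_snd)
    show "integrable (distr M path_space (sample_path A) \<Otimes>\<^sub>M distr M path_space (sample_path D)) (\<lambda>(a, d). F (a, d))"
      by (rule P.integrable_const_bound[where B = 1]) (simp_all add: norm_F)
  qed simp
  also have "\<dots> = (LINT \<omega>|M. LINT a|distr M path_space (sample_path A). F (a, sample_path D \<omega>))"
    by (rule integral_distr) measurable
  also have "\<dots> = (LINT \<omega>|M. exp (complex_of_real (E (t 1) \<omega>) * \<psi> (- K)) * zt (increments t \<omega>))"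
  proof (rule integral_cong_AE)
    show "(\<lambda>\<omega>. LINT a|distr M path_space (sample_path A). F (a, sample_path D \<omega>)) \<in> borel_measurable M"
      by measurable
    have "increments t \<in> M \<rightarrow>\<^sub>M vecs"
      unfolding increments_def using E_meas by (intro measurable_restrict borel_measurable_diff) auto
    then show "(\<lambda>\<omega>. exp (complex_of_real (E (t 1) \<omega>) * \<psi> (- K)) * zt (increments t \<omega>)) \<in> borel_measurable M"
      using E_meas[of "t 1"] by measurable
    show "AE \<omega> in M. (LINT a|distr M path_space (sample_path A). F (a, sample_path D \<omega>))
        = exp (complex_of_real (E (t 1) \<omega>) * \<psi> (- K)) * zt (increments t \<omega>)"
      using AE_unbounded AE_space
    proof eventually_elim
      case (elim \<omega>)
      have D_path: "sample_path D \<omega> \<in> space path_space" by (simp add: space_PiM)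
      have "(LINT a|distr M path_space (sample_path A). F (a, sample_path D \<omega>)) = (LINT \<omega>'|M. F (sample_path A \<omega>', sample_path D \<omega>))"
        by (rule integral_distr) (use D_path in measurable)
      also have "\<dots> = (LINT \<omega>'|M. wave idx (\<lambda>j. A (E (t j) \<omega>) \<omega>'))"
        using elim by (intro Bochner_Integration.integral_cong)
          (simp_all add: F_def E_eq_path_inverse[symmetric] path_eval_A inverse_process_nonneg)
      also have "\<dots> = exp (complex_of_real (E (t 1) \<omega>) * \<psi> (- K)) * zt (\<lambda>j\<in>idx2. E (t j) \<omega> - E (t 1) \<omega>)"
      proof (rule wave_A[of "\<lambda>j. E (t j) \<omega>"])
        show "E (t 1) \<omega> \<le> E (t j) \<omega>" if "j \<in> idx2" for j
          using elim t that by (intro mono_inverse_process ordered_times_pos[of n]) (auto simp: idx2_def)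
      qed (rule inverse_process_nonneg)
      finally show ?case by (simp add: increments_def)
    qed
  qed
  finally show ?thesis .
qed

section \<open>The Fourier-Laplace transform of the time-changed process\<close>

definition p_bar :: complex where
  "p_bar = fourier_laplace idx (ordered_law M (time_changed A D) n) k s"

definition F_bar :: "real \<times> (nat \<Rightarrow> real) \<Rightarrow> complex" where
  "F_bar q = exp (complex_of_real (fst q) * \<psi> (- K)) * zt (snd q)"

lemma measurable_F_bar [measurable]: "F_bar \<in> borel_measurable (borel \<Otimes>\<^sub>M vecs)"
  unfolding F_bar_def by measurable

lemma norm_F_bar: "0 \<le> fst q \<Longrightarrow> norm (F_bar q) \<le> 1"
  using Re_\<psi>[of "- K"] norm_zt[of "snd q"]
  by (auto simp: F_bar_def norm_mult norm_exp_eq_Re mult_nonneg_nonpos intro!: mult_le_one)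

text \<open>\<open>weight\<close> is finite everywhere; this real version serves Bochner
  integrals.\<close>

definition real_weight :: "(nat \<Rightarrow> real) \<Rightarrow> real" where
  "real_weight t = enn2real (weight t)"

lemma weight_eq: "weight t = ennreal (real_weight t)"
  by (simp add: real_weight_def weight_def)

lemma measurable_real_weight [measurable]: "real_weight \<in> borel_measurable times"
  unfolding real_weight_def by measurable

text \<open>Ordered times lie in the domain of the time integral, and at all others both sides are
  0, the law being the null measure there.\<close>

lemma inner_integral:
  assumes t: "t \<in> space times"
  shows "indicator (PiE idx (\<lambda>_. {0..})) t *\<^sub>R (LINT x|ordered_law M (time_changed A D) n t.
      exp (- \<i> * complex_of_real (\<Sum>j\<in>idx. k j * x j) - complex_of_real (\<Sum>j\<in>idx. s j * t j)))
    = (LINT \<omega>|M. real_weight t *\<^sub>R F_bar (E (t 1) \<omega>, increments t \<omega>))"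
proof (cases "ordered_times n t")
  case True
  have "t \<in> PiE idx (\<lambda>_. {0..})"
    using t ordered_times_pos[OF True, folded idx_def] by (force simp: space_PiM PiE_iff)
  moreover have "(LINT x|ordered_law M (time_changed A D) n t.
      exp (- \<i> * complex_of_real (\<Sum>j\<in>idx. k j * x j) - complex_of_real (\<Sum>j\<in>idx. s j * t j)))
      = (LINT x|joint_law M (time_changed A D) idx t. real_weight t *\<^sub>R exp (- \<i> * complex_of_real (\<Sum>j\<in>idx. k j * x j)))"
    using True unfolding ordered_law_def idx_def[symmetric]
    by (simp add: real_weight_def weight_def exp_diff exp_minus
        divide_inverse scaleR_conv_of_real exp_of_real[symmetric] mult.commute)
  moreover have "\<dots> = real_weight t *\<^sub>R fourier idx (joint_law M (time_changed A D) idx t) k"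
    by (simp add: fourier_def)
  moreover have "\<dots> = real_weight t *\<^sub>R (LINT \<omega>|M. wave idx (\<lambda>j. time_changed A D (t j) \<omega>))"
    by (simp add: fourier_joint_law time_changed_meas wave_def)
  ultimately show ?thesis
    by (simp add: wave_time_changed[OF True] F_bar_def)
next
  case False
  then show ?thesis by (simp add: ordered_law_def real_weight_def weight_def)
qed

text \<open>\<open>F_bar\<close> is bounded by 1 only for a nonnegative first coordinate, so G must
  be seen not to charge negative ones.\<close>

lemma integrable_F_bar: "integrable G F_bar"
proof -
  interpret G: finite_measure G by (rule finite_measure_G)
  have "(\<integral>\<^sup>+q. indicator ({..<0} \<times> space vecs) q \<partial>G) = 0"
  proof -
    have "E r \<omega> < 0 \<longleftrightarrow> False" for r \<omega> by (simp add: not_less inverse_process_nonneg)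
    then show ?thesis by (subst nn_integral_G) (simp_all add: indicator_def)
  qed
  then have "{..<0} \<times> space vecs \<in> null_sets G"
    by (auto simp: null_sets_def sets_G)
  then have "AE q in G. 0 \<le> fst q"
    by (rule AE_I') (auto simp: sets_eq_imp_space_eq[OF sets_G] space_pair_measure)
  then show ?thesis
    by (intro G.integrable_const_bound[where B = 1]) (auto elim!: eventually_mono intro: norm_F_bar)
qed

text \<open>In \<open>p_bar\<close> the times are integrated last. Integrability on the product
  space is pulled back from G and justifies reading the iterated integral as one over G.\<close>

lemma p_bar_eq_G: "p_bar = (LINT q|G. F_bar q)"
proof -
  interpret times: sigma_finite_measure times by (rule sigma_finite_times)
  interpret pair_sigma_finite M times ..
  have [measurable]: "(\<lambda>p. E (snd p 1) (fst p)) \<in> borel_measurable (M \<Otimes>\<^sub>M times)"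
    using measurable_E[of 1] by simp
  define H where "H p = real_weight (snd p) *\<^sub>R F_bar (E (snd p 1) (fst p), increments (snd p) (fst p))" for p
  have G_def': "G = distr (density (M \<Otimes>\<^sub>M times) (\<lambda>p. ennreal (real_weight (snd p)))) (borel \<Otimes>\<^sub>M vecs)
      (\<lambda>p. (E (snd p 1) (fst p), increments (snd p) (fst p)))"
    by (simp add: G_def weight_eq)
  have "integrable (M \<Otimes>\<^sub>M times) H"
    using integrable_F_bar unfolding G_def' H_def
    by (subst (asm) integrable_distr_eq, simp, simp, subst (asm) integrable_density) (auto simp: real_weight_def)
  then have "(LINT t|times. LINT \<omega>|M. H (\<omega>, t)) = (LINT p|(M \<Otimes>\<^sub>M times). H p)"
    by (subst integral_snd) auto
  also have "\<dots> = (LINT q|G. F_bar q)"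
    unfolding G_def' H_def
    by (subst integral_distr, simp, simp, subst integral_density) (auto simp: real_weight_def)
  finally have "(LINT t|times. LINT \<omega>|M. H (\<omega>, t)) = (LINT q|G. F_bar q)" .
  moreover have "p_bar = (LINT t|times. LINT \<omega>|M. H (\<omega>, t))"
    unfolding p_bar_def fourier_laplace_def set_lebesgue_integral_def H_def
    by (intro Bochner_Integration.integral_cong refl) (simp only: inner_integral fst_conv snd_conv)
  ultimately show ?thesis by simp
qed

text \<open>Both the measure and the integrand factorise, and the density exp(\<phi> u) merges with
  exp(u \<psi>(-K)) into one exponential with negative real rate.\<close>

lemma integral_G_F_bar: "(LINT q|G. F_bar q) = - 1 / (complex_of_real \<phi> + \<psi> (- K)) * (LINT w|h0. zt w)"
proof -
  interpret e: finite_measure exp_measure by (rule finite_measure_exp_measure)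
  interpret h0: finite_measure h0 by (rule finite_measure_h0)
  interpret pair_sigma_finite exp_measure h0 ..
  have "(LINT q|G. F_bar q) = (LINT u|exp_measure. LINT w|h0. F_bar (u, w))"
    using integrable_F_bar unfolding G_eq[symmetric] by (rule integral_fst'[symmetric])
  also have "\<dots> = (LINT u|exp_measure. exp (complex_of_real u * \<psi> (- K))) * (LINT w|h0. zt w)"
    by (simp add: F_bar_def)
  also have "(LINT u|exp_measure. exp (complex_of_real u * \<psi> (- K)))
      = (LINT u|lborel. indicator {0<..} u *\<^sub>R exp (complex_of_real u * (complex_of_real \<phi> + \<psi> (- K))))"
  proof -
    have "exp_measure = density lborel (\<lambda>u. ennreal (exp (\<phi> * u) * indicator {0<..} u))"
      unfolding exp_measure_def by (intro arg_cong[where f = "density lborel"]) (auto simp: fun_eq_iff indicator_def)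
    then have "(LINT u|exp_measure. exp (complex_of_real u * \<psi> (- K)))
        = (LINT u|lborel. (exp (\<phi> * u) * indicator {0<..} u) *\<^sub>R exp (complex_of_real u * \<psi> (- K)))"
      by (simp only:) (subst integral_density, auto)
    also have "\<dots> = (LINT u|lborel. indicator {0<..} u *\<^sub>R exp (complex_of_real u * (complex_of_real \<phi> + \<psi> (- K))))"
      by (intro Bochner_Integration.integral_cong refl)
        (auto simp: indicator_def distrib_left exp_add scaleR_conv_of_real exp_of_real[symmetric] mult.commute)
    finally show ?thesis .
  qed
  also have "\<dots> = - 1 / (complex_of_real \<phi> + \<psi> (- K))"
    using \<phi>_neg Re_\<psi>[of "- K"] by (intro integral_exp_greaterThan) simp
  finally show ?thesis .
qed

text \<open>\<open>zt\<close> agrees with the Fourier transform of z at nonnegative times, in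
  particular on the ordered region, and \<open>h0\<close> is concentrated there.\<close>

lemma integral_region_zt:
  "(LINT u:ordered_region n|h0. fourier idx2 (joint_law M A idx2 u) k) = (LINT w|h0. zt w)"
proof -
  have "(LINT u:ordered_region n|h0. fourier idx2 (joint_law M A idx2 u) k)
      = (LINT w|h0. indicator (ordered_region n \<inter> space vecs) w *\<^sub>R zt w)"
    unfolding set_lebesgue_integral_def
  proof (intro Bochner_Integration.integral_cong refl)
    fix w assume "w \<in> space h0"
    then have "w \<in> space vecs" by (simp add: sets_eq_imp_space_eq[OF sets_h0])
    then show "indicator (ordered_region n) w *\<^sub>R fourier idx2 (joint_law M A idx2 w) k
        = indicator (ordered_region n \<inter> space vecs) w *\<^sub>R zt w"
      by (auto simp: indicator_def ordered_region_def idx2_def[symmetric] PiE_iff intro!: fourier_z)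
  qed
  also have "\<dots> = (LINT w|h0. zt w)"
  proof (rule integral_cong_AE)
    show "AE w in h0. indicator (ordered_region n \<inter> space vecs) w *\<^sub>R zt w = zt w"
      using AE_h0_region AE_space
      by eventually_elim (simp add: sets_eq_imp_space_eq[OF sets_h0])
  qed (use measurable_ordered_region in measurable)
  finally show ?thesis .
qed

theorem transformed_equation:
  "complex_of_real (- \<phi>) * p_bar = \<psi> (- K) * p_bar
    + (LINT u:ordered_region n|hhat_zero_plus n (ordered_law M E n) s. fourier idx2 (joint_law M A idx2 u) k)"
proof -
  have "hhat_zero_plus n (ordered_law M E n) s = h0"
    by (simp add: hhat_zero_plus_def is_hhat_zero_plus_iff)
  \<comment> \<open>The real part is negative, so the denominator can be cleared.\<close>
  moreover have "complex_of_real \<phi> + \<psi> (- K) \<noteq> 0"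
    using \<phi>_neg Re_\<psi>[of "- K"] by (auto simp: complex_eq_iff)
  ultimately show ?thesis
    unfolding p_bar_eq_G integral_G_F_bar by (simp add: integral_region_zt field_simps)
qed

end

text \<open>The clause of unique existence certifies that the definite description
  \<open>hhat_zero_plus\<close> denotes the intended measure. For n = 1 the set {2..n} is empty: the
  boundary measure lives on one point, the Fourier factor is 1, and the last term is the mass of
  that point.\<close>

theorem corollary1:
  fixes M :: "'a measure"
    and A D :: "real \<Rightarrow> 'a \<Rightarrow> real"
    and \<psi> :: "real \<Rightarrow> complex"
    and K\<^sub>2 :: "real measure"
    and n :: nat
  assumes "levy_process M A"
    and "\<And>u k. 0 \<le> u \<Longrightarrow>
           (LINT \<omega>|M. exp (\<i> * complex_of_real (k * A u \<omega>))) = exp (complex_of_real u * \<psi> k)"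
    and "subordinator M D"
    and "strictly_increasing M D"
    and "\<And>u s. 0 \<le> u \<Longrightarrow> 0 \<le> s \<Longrightarrow>
           (LINT \<omega>|M. exp (- s * D u \<omega>)) = exp (u * laplace_exponent K\<^sub>2 s)"
    and "indep_processes M A D"
    and "sets K\<^sub>2 = sets borel"
    and "emeasure K\<^sub>2 {..<0} = 0"
    and "emeasure K\<^sub>2 {0} = 0"
    and "(\<integral>\<^sup>+y. ennreal (min y 1) \<partial>K\<^sub>2) < \<infinity>"
    and "emeasure K\<^sub>2 UNIV = \<infinity>"
    and "1 \<le> n"
  shows "let p = ordered_law M (time_changed A D) n;
             h = ordered_law M (inverse_process D) n;
             z = joint_law M A {2..n}
         in \<forall>k s. (\<forall>i\<in>{1..n}. 0 < s i) \<longrightarrow>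
              (\<exists>!\<mu>. is_hhat_zero_plus n h s \<mu>) \<and>
              complex_of_real (- laplace_exponent K\<^sub>2 (\<Sum>i\<in>{1..n}. s i)) * fourier_laplace {1..n} p k s
              = \<psi> (- (\<Sum>i\<in>{1..n}. k i)) * fourier_laplace {1..n} p k s
                + (LINT u:ordered_region n|hhat_zero_plus n h s. fourier {2..n} (z u) k)"
  unfolding Let_def
proof (intro allI impI)
  fix k s :: "nat \<Rightarrow> real"
  assume s: "\<forall>i\<in>{1..n}. 0 < s i"
  \<comment> \<open>The locale is instantiated for each s and k separately, with the Laplace
    exponent evaluated at the sum of the \<open>s i\<close>.\<close>
  interpret subordinated_process M D n s "laplace_exponent K\<^sub>2 (\<Sum>i\<in>{1..n}. s i)" A \<psi> k
  proof (intro subordinated_process.intro inverse_subordinator.intro inverse_subordinator_axioms.intro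
      subordinated_process_axioms.intro)
    show "prob_space M" using assms(1) by (rule levy_processD)
    show "levy_process M D" using assms(3) by (simp add: subordinator_def)
    show "(LINT \<omega>|M. exp (- (\<Sum>i\<in>{1..n}. s i) * D u \<omega>)) = exp (u * laplace_exponent K\<^sub>2 (\<Sum>i\<in>{1..n}. s i))"
      if "0 \<le> u" for u
      using s that by (intro assms(5) sum_nonneg) (auto intro: less_imp_le)
  qed (use assms s in auto)
  show "(\<exists>!\<mu>. is_hhat_zero_plus n (ordered_law M (inverse_process D) n) s \<mu>) \<and>
      complex_of_real (- laplace_exponent K\<^sub>2 (\<Sum>i\<in>{1..n}. s i))
        * fourier_laplace {1..n} (ordered_law M (time_changed A D) n) k s
      = \<psi> (- (\<Sum>i\<in>{1..n}. k i)) * fourier_laplace {1..n} (ordered_law M (time_changed A D) n) k s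
        + (LINT u:ordered_region n|hhat_zero_plus n (ordered_law M (inverse_process D) n) s.
            fourier {2..n} (joint_law M A {2..n} u) k)"
    using transformed_equation by (simp add: is_hhat_zero_plus_iff p_bar_def K_def idx_def idx2_def)
qed

end
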